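(* Let $A_5(n)$ be defined by $\sum_{n\ge 0}A_5(n)q^n=\dfrac{f_5^{10}}{f_1^2}$, and let $\{B_k\}_{k\ge 0}$ be defined by $B_0=0$, $B_1=1$ and $B_k=-4B_{k-1}-8B_{k-2}+\dfrac{8^k-1}{7}$ for $k\ge 2$. Then for every integer $k\ge 1$, \[ \sum_{n=-1}^\infty A_5(2^kn+2^{k+1}-2)q^n = B_k\frac{f_1^4f_5^4}{q}-8B_{k-1}f_2^4f_{10}^4+\frac{8^{k+1}-1}{7}\cdot\frac{f_5^{10}}{f_1^2}-\frac{8^{k+1}-8}{7}\cdot \frac{q^2f_{10}^{10}}{f_2^2} \] as formal power series (Laurent series) in $q$.
   Context: For $m\in\mathbb{N}$ and $|q|<1$, $f_m:=\prod_{n\ge1}(1-q^{mn})$. $A_5(n)$ is the number of partition pairs of $n$ with $5$-cores, i.e. pairs $(\lambda,\mu)$ of $5$-core partitions (no hook length divisible by $5$) whose parts sum in total to $n$; its generating function is $\sum_{n\ge0}A_5(n)q^n=f_5^{10}/f_1^2$, with $A_5(0)=1$. *)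

theory Defs
  imports "HOL-Computational_Algebra.Computational_Algebra"
begin

text \<open>The Euler product f_m = prod_{n>=1} (1 - q^(m n)) as a formal power series over the
rationals.  For m >= 1 the coefficient of q^N only depends on the factors with n <= N,
so the N-th coefficient is that of the finite partial product.\<close>
definition euler_f :: "nat \<Rightarrow> rat fps" where
  "euler_f m = Abs_fps (\<lambda>N. fps_nth (\<Prod>j\<in>{1..N}. (1 - fps_X ^ (m * j))) N)"

definition fL :: "nat \<Rightarrow> rat fls" where
  "fL m = fps_to_fls (euler_f m)"

definition A5 :: "nat \<Rightarrow> rat" where
  "A5 n = fls_nth (fL 5 ^ 10 / fL 1 ^ 2) (int n)"

fun B :: "nat \<Rightarrow> rat" where
  "B 0 = 0"
| "B (Suc 0) = 1"
| "B (Suc (Suc k)) = -4 * B (Suc k) - 8 * B k + (8 ^ (Suc (Suc k)) - 1) / 7"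

end

theory Submission
  imports Defs
begin

text \<open>
  Write $g = q f_1^4 f_5^4$, $h = q f_5^5 / f_1$ and let $V$ substitute $q^2$ for $q$. The terms of even
  degree of $g$ and of $h^2 = \sum_n A_5(n) q^{n+2}$ are $V(-4 g - 8 V g)$ and $V(g + 9 h^2 - 8 V h^2)$
  (the action of the Hecke operator $T_2$ on forms of weight 4 and level 5), and iterating these two
  relations gives the recurrence for $B_k$.

  Both relations are rational identities on the modular curve of level 10. Its coordinate
  $u = f_1^3 f_5 / (q f_2 f_{10}^3)$ is such that $u + 4$ and $u + 5$ are eta quotients as well; comparing
  products, $u(q) u(-q)$ and $(u(q) + 4)(u(-q) + 4)$ are rational functions of $u(q^2)$, which determines
  the symmetric functions of $u(q)$ and $u(-q)$. That $u + 4$ and $u + 5$ are eta quotients follows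
  from $\varphi(q)^2 - \varphi(q^5)^2 = 4 q f(q, q^9) f(q^3, q^7)$ and
  $\psi(q)^2 - q \psi(q^5)^2 = f(q, q^4) f(q^2, q^3)$. After Jacobi's triple product identity these are
  statements about sums over the Gaussian integers, split into the five cosets of an ideal of norm 5.
\<close>

section \<open>Infinite products of formal power series\<close>

text \<open>Convergence of formal power series means that each coefficient is eventually constant,
  and a coefficient of a product depends on finitely many coefficients of the factors.\<close>

lemma tendsto_mult_fps:
  fixes f g :: "'b \<Rightarrow> 'a::comm_ring_1 fps"
  assumes "(f \<longlongrightarrow> a) F" "(g \<longlongrightarrow> b) F"
  shows "((\<lambda>x. f x * g x) \<longlongrightarrow> a * b) F"
proof (rule tendsto_fpsI)
  fix n
  have "\<forall>\<^sub>F x in F. \<forall>k\<in>{..n}. fps_nth (f x) k = fps_nth a k \<and> fps_nth (g x) k = fps_nth b k"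
    by (subst eventually_ball_finite_distrib)
       (use assms in \<open>auto simp: tendsto_fps_iff eventually_conj_iff\<close>)
  then show "\<forall>\<^sub>F x in F. fps_nth (f x * g x) n = fps_nth (a * b) n"
    by eventually_elim (auto simp: fps_mult_nth intro!: sum.cong)
qed

lemma tendsto_sum_fps:
  fixes f :: "'c \<Rightarrow> 'b \<Rightarrow> 'a::comm_ring_1 fps"
  assumes "\<And>i. i \<in> I \<Longrightarrow> (f i \<longlongrightarrow> a i) F"
  shows "((\<lambda>x. \<Sum>i\<in>I. f i x) \<longlongrightarrow> (\<Sum>i\<in>I. a i)) F"
proof (cases "finite I")
  case True
  show ?thesis
  proof (rule tendsto_fpsI)
    fix n
    have "\<forall>\<^sub>F x in F. \<forall>i\<in>I. fps_nth (f i x) n = fps_nth (a i) n"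
      by (subst eventually_ball_finite_distrib)
         (use assms True in \<open>auto simp: tendsto_fps_iff\<close>)
    then show "\<forall>\<^sub>F x in F. fps_nth (\<Sum>i\<in>I. f i x) n = fps_nth (\<Sum>i\<in>I. a i) n"
      by eventually_elim (auto simp: fps_sum_nth intro!: sum.cong)
  qed
qed simp

text \<open>A factor \<open>f k\<close> with \<open>k > N\<close> changes a product only in degrees
  above \<open>N\<close>, so the coefficient of degree \<open>N\<close> is final once the factors up
  to index \<open>N\<close> are present.\<close>

lemma tendsto_prod_fps_dvd:
  fixes f :: "nat \<Rightarrow> 'a::comm_ring_1 fps"
  assumes "\<And>k. fps_X ^ k dvd f k - 1"
  shows "(\<lambda>n. \<Prod>k<n. f k) \<longlonglongrightarrow> Abs_fps (\<lambda>N. fps_nth (\<Prod>k<Suc N. f k) N)"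
proof (rule tendsto_fpsI)
  fix N
  have step: "fps_nth (g * f k) N = fps_nth g N" if "N < k" for g k
  proof -
    obtain h where "f k - 1 = fps_X ^ k * h"
      using assms[of k] by (elim dvdE)
    then have "g * f k = g + fps_X ^ k * (g * h)"
      by (simp add: algebra_simps)
    then show ?thesis
      using that by (simp add: fps_X_power_mult_nth)
  qed
  have "fps_nth (\<Prod>k<n. f k) N = fps_nth (\<Prod>k<Suc N. f k) N" if "n \<ge> Suc N" for n
    using that
  proof (induction n rule: dec_induct)
    case (step n)
    then show ?case
      using assms \<open>\<And>g k. N < k \<Longrightarrow> fps_nth (g * f k) N = fps_nth g N\<close> by simp
  qed simp
  then show "\<forall>\<^sub>F n in sequentially. fps_nth (\<Prod>k<n. f k) N =
      fps_nth (Abs_fps (\<lambda>N. fps_nth (\<Prod>k<Suc N. f k) N)) N"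
    unfolding eventually_sequentially by auto
qed

text \<open>The product written $(-q^a; q^c)_\infty$.\<close>

definition qprod :: "nat \<Rightarrow> nat \<Rightarrow> rat fps" where
  "qprod a c = lim (\<lambda>n. \<Prod>k<n. 1 + fps_X ^ (a + c * k))"

lemma le_mult_self: "c > 0 \<Longrightarrow> k \<le> c * (k::nat)"
  by simp

lemma tendsto_qprod:
  assumes "c > 0"
  shows "(\<lambda>n. \<Prod>k<n. 1 + fps_X ^ (a + c * k)) \<longlonglongrightarrow> qprod a c"
proof -
  have "convergent (\<lambda>n. \<Prod>k<n. 1 + fps_X ^ (a + c * k) :: rat fps)"
    unfolding convergent_def
    by (rule exI, rule tendsto_prod_fps_dvd) (use assms in \<open>auto intro!: le_imp_power_dvd trans_le_add2\<close>)
  then show ?thesis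
    unfolding qprod_def by (simp add: convergent_LIMSEQ_iff)
qed

lemma tendsto_euler_f:
  assumes "m > 0"
  shows "(\<lambda>n. \<Prod>k<n. 1 - fps_X ^ (m * Suc k)) \<longlonglongrightarrow> euler_f m"
proof -
  let ?f = "\<lambda>k. 1 - fps_X ^ (m * Suc k) :: rat fps"
  have dvd: "fps_X ^ k dvd ?f k - 1" for k
  proof -
    have "k \<le> m * k" using assms by simp
    also have "\<dots> \<le> m * Suc k" by simp
    finally show ?thesis by (simp add: le_imp_power_dvd del: mult_Suc_right)
  qed
  have "fps_nth (\<Prod>k<Suc N. ?f k) N = fps_nth (euler_f m) N" for N
  proof -
    \<comment> \<open>The general limit truncates after \<open>N + 1\<close> factors,
      \<open>euler_f\<close> after \<open>N\<close>. The extra factor differs from 1 only in degree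
      \<open>m * Suc N > N\<close>.\<close>
    have "N < m * Suc N" using assms
      by (metis Suc_le_eq le_mult_self)
    moreover have "(\<Prod>k<Suc N. ?f k) = (\<Prod>k<N. ?f k) - fps_X ^ (m * Suc N) * (\<Prod>k<N. ?f k)"
      by (simp add: algebra_simps del: mult_Suc_right)
    ultimately have "fps_nth (\<Prod>k<Suc N. ?f k) N = fps_nth (\<Prod>k<N. ?f k) N"
      by (simp add: fps_X_power_mult_nth del: mult_Suc_right prod.lessThan_Suc)
    also have "(\<Prod>k<N. ?f k) = (\<Prod>j\<in>{1..N}. 1 - fps_X ^ (m * j))"
      by (simp add: prod.atLeast1_atMost_eq)
    finally show ?thesis by (simp add: euler_f_def)
  qed
  then have "Abs_fps (\<lambda>N. fps_nth (\<Prod>k<Suc N. ?f k) N) = euler_f m"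
    by (simp add: fps_eq_iff)
  with tendsto_prod_fps_dvd[of ?f] dvd show ?thesis by simp
qed

lemma filterlim_mult_left_nat: "c > 0 \<Longrightarrow> filterlim (\<lambda>n. c * n :: nat) sequentially sequentially"
  by (rule filterlim_subseq) (auto simp: strict_mono_def)

lemma prod_lessThan_mult:
  fixes f :: "nat \<Rightarrow> 'a::comm_monoid_mult"
  shows "(\<Prod>k<m * n. f k) = (\<Prod>r<m. \<Prod>k<n. f (r + m * k))"
proof (induction n)
  case (Suc n)
  have "(\<Prod>k<m * Suc n. f k) = (\<Prod>k<m * n. f k) * (\<Prod>k\<in>{m * n..<m * n + m}. f k)"
    by (subst prod.union_disjoint[symmetric]) (auto intro!: prod.cong)
  also have "(\<Prod>k\<in>{m * n..<m * n + m}. f k) = (\<Prod>r<m. f (r + m * n))"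
    using prod.shift_bounds_nat_ivl[of f 0 "m * n" m] by (simp add: lessThan_atLeast0 add.commute)
  finally show ?case using Suc by (simp add: prod.distrib)
qed simp

lemma tendsto_finite_prod_fps:
  fixes f :: "'c \<Rightarrow> 'b \<Rightarrow> 'a::comm_ring_1 fps"
  assumes "\<And>i. i \<in> I \<Longrightarrow> (f i \<longlongrightarrow> a i) F"
  shows "((\<lambda>x. \<Prod>i\<in>I. f i x) \<longlongrightarrow> (\<Prod>i\<in>I. a i)) F"
  using assms by (induction I rule: infinite_finite_induct) (auto intro: tendsto_mult_fps)

text \<open>The factors are sorted by the residue of their index modulo \<open>m\<close>; both sides
  are limits of the partial products with \<open>m * n\<close> factors.\<close>

lemma qprod_split:
  assumes "c > 0" "m > 0"
  shows "qprod a c = (\<Prod>r<m. qprod (a + c * r) (m * c))"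
proof (rule LIMSEQ_unique)
  show "(\<lambda>n. \<Prod>k<m * n. 1 + fps_X ^ (a + c * k)) \<longlonglongrightarrow> qprod a c"
    using filterlim_compose[OF tendsto_qprod[OF assms(1)] filterlim_mult_left_nat[OF assms(2)]] .
  have "(\<lambda>n. \<Prod>r<m. \<Prod>k<n. 1 + fps_X ^ (a + c * r + m * c * k)) \<longlonglongrightarrow>
      (\<Prod>r<m. qprod (a + c * r) (m * c))"
    using assms by (intro tendsto_finite_prod_fps tendsto_qprod) simp
  then show "(\<lambda>n. \<Prod>k<m * n. 1 + fps_X ^ (a + c * k)) \<longlonglongrightarrow> (\<Prod>r<m. qprod (a + c * r) (m * c))"
    by (simp add: prod_lessThan_mult distrib_left mult.assoc mult.left_commute[of c] add.assoc)
qed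

text \<open>The factor of index 0 is \<open>1 + q^0 = 2\<close>.\<close>

lemma qprod_0:
  assumes "c > 0"
  shows "qprod 0 c = 2 * qprod c c"
proof (rule LIMSEQ_unique)
  show "(\<lambda>n. \<Prod>k<Suc n. 1 + fps_X ^ (0 + c * k)) \<longlonglongrightarrow> qprod 0 c"
    using filterlim_compose[OF tendsto_qprod[OF assms] filterlim_Suc] .
  have "(\<lambda>n. 2 * (\<Prod>k<n. 1 + fps_X ^ (c + c * k))) \<longlonglongrightarrow> 2 * qprod c c"
    by (intro tendsto_mult_fps tendsto_const tendsto_qprod assms)
  then show "(\<lambda>n. \<Prod>k<Suc n. 1 + fps_X ^ (0 + c * k)) \<longlonglongrightarrow> 2 * qprod c c"
    by (simp add: prod.lessThan_Suc_shift del: prod.lessThan_Suc)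
qed

text \<open>Factor by factor this is \<open>(1 + x) * (1 - x) = 1 - x^2\<close>.\<close>

lemma qprod_mult_euler_f:
  assumes "c > 0"
  shows "qprod c c * euler_f c = euler_f (2 * c)"
proof (rule LIMSEQ_unique)
  show "(\<lambda>n. (\<Prod>k<n. 1 + fps_X ^ (c + c * k)) * (\<Prod>k<n. 1 - fps_X ^ (c * Suc k)))
      \<longlonglongrightarrow> qprod c c * euler_f c"
    by (intro tendsto_mult_fps tendsto_qprod tendsto_euler_f assms)
  have "(\<Prod>k<n. 1 + fps_X ^ (c + c * k)) * (\<Prod>k<n. 1 - fps_X ^ (c * Suc k)) =
      (\<Prod>k<n. 1 - fps_X ^ (2 * c * Suc k) :: rat fps)" for n
    unfolding prod.distrib[symmetric]
  proof (rule prod.cong)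
    fix k
    have "(1 + x) * (1 - x) = 1 - x * x" for x :: "rat fps"
      by (simp add: algebra_simps)
    then show "(1 + fps_X ^ (c + c * k)) * (1 - fps_X ^ (c * Suc k)) = (1 - fps_X ^ (2 * c * Suc k) :: rat fps)"
      by (simp add: mult_2 distrib_right flip: power_add)
  qed simp
  moreover have "(\<lambda>n. \<Prod>k<n. 1 - fps_X ^ (2 * c * Suc k)) \<longlonglongrightarrow> euler_f (2 * c)"
    using assms by (intro tendsto_euler_f) simp
  ultimately show "(\<lambda>n. (\<Prod>k<n. 1 + fps_X ^ (c + c * k)) * (\<Prod>k<n. 1 - fps_X ^ (c * Suc k)))
      \<longlonglongrightarrow> euler_f (2 * c)"
    by simp
qed

section \<open>Theta series and Jacobi's triple product identity\<close>

text \<open>The division is exact, since the numerator is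
  \<open>a j (j + 1) + b j (j - 1)\<close>.\<close>

definition theta_exponent :: "nat \<Rightarrow> nat \<Rightarrow> int \<Rightarrow> int" where
  "theta_exponent a b j = ((int a + int b) * j\<^sup>2 + (int a - int b) * j) div 2"

text \<open>Ramanujan's theta function $f(q^a, q^b) = \sum_{j \in Z} q^{a j (j+1)/2 + b j (j-1)/2}$.\<close>

definition theta :: "nat \<Rightarrow> nat \<Rightarrow> rat fps" where
  "theta a b = Abs_fps (\<lambda>N. of_nat (card {j. theta_exponent a b j = int N}))"

lemma double_theta_exponent:
  "2 * theta_exponent a b j = (int a + int b) * j\<^sup>2 + (int a - int b) * j"
proof -
  have "(int a + int b) * j\<^sup>2 + (int a - int b) * j = int a * (j * (j + 1)) + int b * (j * (j - 1))"
    by (simp add: algebra_simps power2_eq_square)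
  also have "even \<dots>" by simp
  finally show ?thesis unfolding theta_exponent_def by simp
qed

lemma theta_exponent_uminus: "theta_exponent a b (- j) = theta_exponent b a j"
  using double_theta_exponent[of a b "- j"] double_theta_exponent[of b a j]
  by (simp add: algebra_simps)

lemma theta_exponent_plus_one: "theta_exponent a b (j + 1) = theta_exponent a b j + int a + int (a + b) * j"
  using double_theta_exponent[of a b "j + 1"] double_theta_exponent[of a b j]
  by (simp add: algebra_simps power2_eq_square)

text \<open>With \<open>t = |j|\<close>, both \<open>j (j + 1)\<close> and \<open>j (j - 1)\<close>
  are at least \<open>t (t - 1)\<close>, and one of \<open>a\<close>, \<open>b\<close> is at least
  1. Moreover \<open>t (t - 1) >= 2 t - 2\<close> because \<open>(t - 1) (t - 2) >= 0\<close> for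
  integers. The bound makes all the counts below finite.\<close>

lemma abs_le_theta_exponent:
  assumes "a + b > 0"
  shows "\<bar>j\<bar> \<le> theta_exponent a b j + 1"
proof -
  define t where "t = \<bar>j\<bar>"
  have nonneg: "0 \<le> j * (j + 1)" "0 \<le> j * (j - 1)"
    by (cases "j \<ge> 1"; cases "j = 0"; simp add: mult_nonneg_nonneg mult_nonpos_nonpos)+
  have t: "t * (t - 1) \<le> j * (j + 1)" "t * (t - 1) \<le> j * (j - 1)"
    unfolding t_def by (cases "j \<ge> 0"; simp add: algebra_simps)+
  have "t * (t - 1) \<le> int a * (j * (j + 1)) + int b * (j * (j - 1))"
  proof (cases "a > 0")
    case True
    then have "1 * (j * (j + 1)) \<le> int a * (j * (j + 1))"
      using nonneg by (intro mult_right_mono) auto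
    moreover have "0 \<le> int b * (j * (j - 1))" using nonneg by simp
    ultimately show ?thesis using t by linarith
  next
    case False
    then have "1 * (j * (j - 1)) \<le> int b * (j * (j - 1))"
      using nonneg assms by (intro mult_right_mono) auto
    then show ?thesis using t False by simp
  qed
  also have "\<dots> = 2 * theta_exponent a b j"
    by (simp add: double_theta_exponent algebra_simps power2_eq_square)
  finally have "t * (t - 1) \<le> 2 * theta_exponent a b j" .
  moreover have "0 \<le> (t - 1) * (t - 2)"
    by (cases "t \<ge> 2"; simp add: mult_nonneg_nonneg mult_nonpos_nonpos)
  ultimately show ?thesis unfolding t_def[symmetric] by (simp add: algebra_simps)
qed

lemma theta_exponent_nonneg: "theta_exponent a b j \<ge> 0"
proof (cases "a + b > 0")
  case True
  show ?thesis
  proof (cases "j = 0")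
    case False
    then show ?thesis using abs_le_theta_exponent[OF True, of j] by linarith
  qed (simp add: theta_exponent_def)
qed (simp add: theta_exponent_def)

lemma finite_theta_exponent_le:
  assumes "a + b > 0"
  shows "finite {j. theta_exponent a b j \<le> N}"
proof (rule finite_subset)
  show "{j. theta_exponent a b j \<le> N} \<subseteq> {- (N + 1)..N + 1}"
  proof
    fix j assume "j \<in> {j. theta_exponent a b j \<le> N}"
    then show "j \<in> {- (N + 1)..N + 1}"
      using abs_le_theta_exponent[OF assms, of j] by (simp add: abs_le_iff)
  qed
qed simp

lemma finite_theta_exponent_eq:
  assumes "a + b > 0"
  shows "finite {j. theta_exponent a b j = N}"
  by (rule finite_subset[OF _ finite_theta_exponent_le[OF assms, of N]]) auto

lemma theta_commute: "theta a b = theta b a"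
proof -
  have "card {j. theta_exponent a b j = N} = card {j. theta_exponent b a j = N}" for N
    by (rule bij_betw_same_card[of uminus], rule bij_betw_byWitness[of _ uminus])
       (auto simp: theta_exponent_uminus)
  then show ?thesis by (simp add: theta_def)
qed

text \<open>Turns a product of theta series into a lattice point count, to which the decomposition
  into cosets applies.\<close>

lemma nth_theta_mult:
  assumes "a + b > 0" "c + d > 0"
  shows "fps_nth (theta a b * theta c d) N =
    of_nat (card {(i, j). theta_exponent a b i + theta_exponent c d j = int N})"
proof -
  let ?A = "\<lambda>k. {i. theta_exponent a b i = int k}" and ?B = "\<lambda>k. {j. theta_exponent c d j = int k}"
  have "{(i, j). theta_exponent a b i + theta_exponent c d j = int N} = (\<Union>k\<in>{0..N}. ?A k \<times> ?B (N - k))"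
  proof (intro equalityI subsetI)
    fix x assume "x \<in> {(i, j). theta_exponent a b i + theta_exponent c d j = int N}"
    then obtain i j where x: "x = (i, j)" "theta_exponent a b i + theta_exponent c d j = int N" by blast
    then have "x \<in> ?A (nat (theta_exponent a b i)) \<times> ?B (N - nat (theta_exponent a b i))"
        "nat (theta_exponent a b i) \<in> {0..N}"
      using theta_exponent_nonneg[of a b i] theta_exponent_nonneg[of c d j] by auto
    then show "x \<in> (\<Union>k\<in>{0..N}. ?A k \<times> ?B (N - k))" by blast
  qed auto
  also have "card \<dots> = (\<Sum>k=0..N. card (?A k \<times> ?B (N - k)))"
    using assms by (intro card_UN_disjoint) (auto intro: finite_theta_exponent_eq)
  finally show ?thesis
    by (simp add: fps_mult_nth theta_def card_cartesian_product)
qed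

lemma finite_theta_exponent_pairs:
  assumes "a + b > 0" "c + d > 0"
  shows "finite {(i, j). theta_exponent a b i + theta_exponent c d j = N}"
proof (rule finite_subset)
  show "{(i, j). theta_exponent a b i + theta_exponent c d j = N} \<subseteq>
      {i. theta_exponent a b i \<le> N} \<times> {j. theta_exponent c d j \<le> N}"
    using theta_exponent_nonneg[of a b] theta_exponent_nonneg[of c d] by (force simp: add_increasing add_increasing2)
qed (use assms finite_theta_exponent_le in auto)

section \<open>A finite form of Jacobi's triple product identity, and its limit\<close>

definition euler_partial :: "nat \<Rightarrow> nat \<Rightarrow> rat fps" where
  "euler_partial c n = (\<Prod>k<n. 1 - fps_X ^ (c * Suc k))"

text \<open>The convention $1/(Q;Q)_m = 0$ for $m < 0$ makes $1/(Q;Q)_m = (1 - Q^{m+1})/(Q;Q)_{m+1}$ hold for all $m$.\<close>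

definition inv_euler_partial :: "nat \<Rightarrow> int \<Rightarrow> rat fps" where
  "inv_euler_partial c m = (if m < 0 then 0 else inverse (euler_partial c (nat m)))"

lemma euler_partial_nth_0: "c > 0 \<Longrightarrow> fps_nth (euler_partial c n) 0 = 1"
  by (induction n) (simp_all add: euler_partial_def)

lemma inv_euler_partial_step:
  assumes "c > 0"
  shows "inv_euler_partial c m = inv_euler_partial c (m + 1) * (1 - fps_X ^ (c * nat (m + 1)))"
proof (cases "m < 0")
  case False
  let ?E = "euler_partial c" and ?n = "nat m"
  have n: "nat (m + 1) = Suc ?n" using False by simp
  have E: "?E (Suc ?n) = ?E ?n * (1 - fps_X ^ (c * Suc ?n))"
    by (simp add: euler_partial_def)
  have "inverse (?E ?n) = inverse (?E ?n) * (inverse (?E (Suc ?n)) * ?E (Suc ?n))"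
    using assms by (simp add: inverse_mult_eq_1 euler_partial_nth_0)
  also have "\<dots> = (inverse (?E ?n) * ?E ?n) * (inverse (?E (Suc ?n)) * (1 - fps_X ^ (c * Suc ?n)))"
    unfolding E by (simp only: ac_simps)
  also have "\<dots> = inverse (?E (Suc ?n)) * (1 - fps_X ^ (c * Suc ?n))"
    using assms by (simp add: inverse_mult_eq_1 euler_partial_nth_0)
  finally show ?thesis using False unfolding inv_euler_partial_def n by simp
\<comment> \<open>For \<open>m = -1\<close> the factor is \<open>1 - q^0 = 0\<close>; for smaller
  \<open>m\<close> both sides are 0 by convention.\<close>
qed (auto simp: inv_euler_partial_def)

text \<open>Used with \<open>A = Q^(n + j)\<close> and \<open>B = Q^(n - j)\<close>, where
  \<open>A * B * Q = Q^(2 n + 1)\<close>.\<close>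

lemma qbinomial_pascal_identity:
  fixes Q A B :: "'a::comm_ring_1"
  shows "(1 - A * Q) * (1 - B * Q) * (1 + A * B * Q) + (1 - A * Q) * (1 - A) * (B * Q)
      + (1 - B * Q) * (1 - B) * (A * Q) = (1 - A * B * Q) * (1 - A * B * Q * Q)"
  by (simp add: algebra_simps)

text \<open>With \<open>Q = q^c\<close>, the product \<open>I (n + j) * I (n - j)\<close> is the
  Gaussian binomial coefficient of \<open>2 n\<close> over \<open>n + j\<close> divided by
  \<open>(Q;Q)_(2 n)\<close>. The identity is the q-Pascal rule applied twice, from row
  \<open>2 n\<close> to row \<open>2 n + 2\<close>; it is proved by taking out the common factor
  \<open>I (n + 1 + j) * I (n + 1 - j)\<close>.\<close>

lemma inv_euler_partial_pascal:
  fixes c n :: nat and j :: int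
  assumes c: "c > 0" and j: "j \<in> {- int n - 1..int n + 1}"
  defines "I \<equiv> inv_euler_partial c"
  shows "I (n + j) * I (n - j) * (1 + fps_X ^ (c * (2 * n + 1)))
      + I (n + (j - 1)) * I (n - (j - 1)) * fps_X ^ (c * nat (n + 1 - j))
      + I (n + (j + 1)) * I (n - (j + 1)) * fps_X ^ (c * nat (n + 1 + j))
    = I (n + 1 + j) * I (n + 1 - j) * ((1 - fps_X ^ (c * (2 * n + 1))) * (1 - fps_X ^ (c * (2 * n + 2))))"
proof -
  define Q A B A' B' :: "rat fps" where
    "Q = fps_X ^ c" and "A = fps_X ^ (c * nat (n + j))" and "B = fps_X ^ (c * nat (n - j))"
    and "A' = fps_X ^ (c * nat (n + 1 + j))" and "B' = fps_X ^ (c * nat (n + 1 - j))"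
  let ?P = "I (n + 1 + j)" and ?R = "I (n + 1 - j)"
  note step = inv_euler_partial_step[OF c, folded I_def]
  have 1: "I (n + j) = ?P * (1 - A')" "I (n - j) = ?R * (1 - B')"
    using step[of "n + j"] step[of "n - j"] by (simp_all add: A'_def B'_def algebra_simps)
  have "int n + (j - 1) + 1 = n + j" "int n - (j + 1) + 1 = n - j"
    by simp_all
  then have 2: "I (n + (j - 1)) = ?P * (1 - A') * (1 - A)" "I (n - (j + 1)) = ?R * (1 - B') * (1 - B)"
    using step[of "n + (j - 1)"] step[of "n - (j + 1)"] unfolding A_def B_def 1[symmetric] by metis+
  have 3: "I (n - (j - 1)) = ?R" "I (n + (j + 1)) = ?P"
    by (simp_all add: algebra_simps)
  have 4: "A' * B' = fps_X ^ (c * (2 * n + 2))"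
    using j by (simp add: A'_def B'_def flip: power_add distrib_left nat_add_distrib)
      (simp add: nat_add_distrib nat_mult_distrib)
  have key: "(1 - A') * (1 - B') * (1 + fps_X ^ (c * (2 * n + 1))) + (1 - A') * (1 - A) * B'
      + (1 - B') * (1 - B) * A' = (1 - fps_X ^ (c * (2 * n + 1))) * (1 - fps_X ^ (c * (2 * n + 2)))"
  proof -
    \<comment> \<open>At the two ends \<open>nat\<close> cuts an exponent \<open>-1\<close> off to
      0, so \<open>A' = A * Q\<close> or \<open>B' = B * Q\<close> fails. There \<open>A'\<close> or
      \<open>B'\<close> is 1 and the terms containing \<open>1 - A'\<close> or \<open>1 - B'\<close>
      vanish.\<close>
    consider "j = - int n - 1" | "j = int n + 1" | "- int n \<le> j" "j \<le> int n"
      using j by force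
    then show ?thesis
    proof cases
      case 1
      then have "A' = 1" "B' = fps_X ^ (c * (2 * n + 2))" "B = fps_X ^ (c * (2 * n + 1))"
        by (auto simp: A'_def B'_def B_def nat_add_distrib nat_mult_distrib intro!: arg_cong[of _ _ "(^) fps_X"] arg_cong[of _ _ "(*) c"])
      then show ?thesis by (simp only: mult.commute diff_self mult_zero_left mult_zero_right add_0 mult_1_left mult_1_right)
    next
      case 2
      then have "B' = 1" "A' = fps_X ^ (c * (2 * n + 2))" "A = fps_X ^ (c * (2 * n + 1))"
        by (auto simp: A'_def B'_def A_def nat_add_distrib nat_mult_distrib intro!: arg_cong[of _ _ "(^) fps_X"] arg_cong[of _ _ "(*) c"])
      then show ?thesis by (simp only: mult.commute diff_self mult_zero_left mult_zero_right add_0 add_0_right mult_1_left mult_1_right)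
    next
      case 3
      then have "nat (n + 1 + j) = Suc (nat (n + j))" "nat (n + 1 - j) = Suc (nat (n - j))"
        by linarith+
      then have "A' = A * Q" "B' = B * Q"
        by (simp_all add: A'_def A_def B'_def B_def Q_def power_add)
      moreover from 3 have "fps_X ^ (c * (2 * n + 1)) = A * B * Q"
        by (simp add: A_def B_def Q_def flip: power_add mult_Suc_right distrib_left nat_add_distrib)
          (simp add: nat_add_distrib nat_mult_distrib)
      moreover have "fps_X ^ (c * (2 * n + 2)) = fps_X ^ (c * (2 * n + 1)) * Q"
        by (simp add: Q_def algebra_simps flip: power_add)
      ultimately show ?thesis
        using qbinomial_pascal_identity[of A Q B] by simp
    qed
  qed
  show ?thesis
    unfolding 1 2 3 A'_def[symmetric] B'_def[symmetric]
    using arg_cong[OF key, of "\<lambda>x. ?P * ?R * x"] by (simp add: algebra_simps)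
qed

text \<open>A theta sum weighted by Gaussian binomial coefficients, divided by
  \<open>(Q;Q)_(2 n)\<close> for \<open>Q = q^(a + b)\<close>. In this normalisation each weight
  tends to \<open>1 / (Q;Q)_infinity^2\<close>.\<close>

definition theta_partial :: "nat \<Rightarrow> nat \<Rightarrow> nat \<Rightarrow> rat fps" where
  "theta_partial a b n = (\<Sum>j\<in>{- int n..int n}. inv_euler_partial (a + b) (n + j) *
     inv_euler_partial (a + b) (n - j) * fps_X ^ nat (theta_exponent a b j))"

lemma theta_partial_wider:
  assumes "{- int n..int n} \<subseteq> J" "finite J"
  shows "theta_partial a b n = (\<Sum>j\<in>J. inv_euler_partial (a + b) (n + j) *
     inv_euler_partial (a + b) (n - j) * fps_X ^ nat (theta_exponent a b j))"
  unfolding theta_partial_def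
  by (rule sum.mono_neutral_left) (use assms in \<open>auto simp: inv_euler_partial_def\<close>)

text \<open>The two factors on the left multiply out to \<open>1 + Q^(2 n + 1)\<close> plus two
  single powers of \<open>q\<close>. Shifting \<open>j\<close> by one in the sums that carry these
  powers gives all terms the same power \<open>q^(e j)\<close>, and the q-Pascal rule collects their
  coefficients.\<close>

lemma theta_partial_Suc:
  assumes "a + b > 0"
  shows "(1 + fps_X ^ (a + (a + b) * n)) * (1 + fps_X ^ (b + (a + b) * n)) * theta_partial a b n
    = (1 - fps_X ^ ((a + b) * (2 * n + 1))) * (1 - fps_X ^ ((a + b) * (2 * n + 2))) * theta_partial a b (Suc n)"
proof -
  define c where "c = a + b"
  define I where "I = inv_euler_partial c"
  define e where "e j = nat (theta_exponent a b j)" for j :: int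
  let ?J = "{- int n - 1..int n + 1}"
  define t where "t j = I (n + j) * I (n - j)" for j :: int
  have c: "c > 0" using assms by (simp add: c_def)
  have t0: "t j = 0" if "j \<notin> {- int n..int n}" for j :: int
    using that by (auto simp: t_def I_def inv_euler_partial_def)
  have T: "theta_partial a b n = (\<Sum>j\<in>J. t j * fps_X ^ e j)"
    if "{- int n..int n} \<subseteq> J" "finite J" for J
    using theta_partial_wider[OF that] by (simp add: t_def I_def c_def e_def)
  have e_minus: "e (j - 1) + (a + c * n) = e j + c * nat (n + 1 - j)" if "j \<in> ?J" for j :: int
  proof -
    have "theta_exponent a b j = theta_exponent a b (j - 1) + int a + int c * (j - 1)"
      using theta_exponent_plus_one[of a b "j - 1"] by (simp add: c_def)
    then have "int (e (j - 1) + (a + c * n)) = int (e j + c * nat (n + 1 - j))"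
      using that theta_exponent_nonneg[of a b] by (simp add: e_def algebra_simps)
    then show ?thesis by linarith
  qed
  have e_plus: "e (j + 1) + (b + c * n) = e j + c * nat (n + 1 + j)" if "j \<in> ?J" for j :: int
  proof -
    have "int (e (j + 1) + (b + c * n)) = int (e j + c * nat (n + 1 + j))"
      using that theta_exponent_nonneg[of a b j] theta_exponent_nonneg[of a b "j + 1"] theta_exponent_plus_one[of a b j]
      by (simp add: e_def c_def algebra_simps)
    then show ?thesis by linarith
  qed
  \<comment> \<open>The shifted range still contains \<open>{- n..n}\<close>, outside of which the
    weights vanish.\<close>
  have shift_minus: "theta_partial a b n = (\<Sum>j\<in>?J. t (j - 1) * fps_X ^ e (j - 1))"
  proof -
    have "(\<Sum>j\<in>?J. t (j - 1) * fps_X ^ e (j - 1)) = (\<Sum>j\<in>{- int n - 2..int n}. t j * fps_X ^ e j)"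
      by (rule sum.reindex_bij_witness[of _ "\<lambda>j. j + 1" "\<lambda>j. j - 1"]) auto
    then show ?thesis using T[of "{- int n - 2..int n}"] by simp
  qed
  have shift_plus: "theta_partial a b n = (\<Sum>j\<in>?J. t (j + 1) * fps_X ^ e (j + 1))"
  proof -
    have "(\<Sum>j\<in>?J. t (j + 1) * fps_X ^ e (j + 1)) = (\<Sum>j\<in>{- int n..int n + 2}. t j * fps_X ^ e j)"
      by (rule sum.reindex_bij_witness[of _ "\<lambda>j. j - 1" "\<lambda>j. j + 1"]) auto
    then show ?thesis using T[of "{- int n..int n + 2}"] by simp
  qed
  have "(a + c * n) + (b + c * n) = c * (2 * n + 1)"
    by (simp add: c_def algebra_simps)
  then have "(1 + fps_X ^ (a + c * n)) * (1 + fps_X ^ (b + c * n)) =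
      1 + fps_X ^ (c * (2 * n + 1)) + fps_X ^ (a + c * n) + (fps_X ^ (b + c * n) :: rat fps)"
    by (simp only: distrib_left distrib_right mult_1_left mult_1_right power_add[symmetric] ac_simps)
  then have "(1 + fps_X ^ (a + c * n)) * (1 + fps_X ^ (b + c * n)) * theta_partial a b n =
      (1 + fps_X ^ (c * (2 * n + 1))) * theta_partial a b n
      + fps_X ^ (a + c * n) * theta_partial a b n + fps_X ^ (b + c * n) * theta_partial a b n"
    by (simp only: distrib_right)
  also have "\<dots> = (1 + fps_X ^ (c * (2 * n + 1))) * (\<Sum>j\<in>?J. t j * fps_X ^ e j)
      + fps_X ^ (a + c * n) * (\<Sum>j\<in>?J. t (j - 1) * fps_X ^ e (j - 1))
      + fps_X ^ (b + c * n) * (\<Sum>j\<in>?J. t (j + 1) * fps_X ^ e (j + 1))"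
    using T[of ?J] shift_minus shift_plus by simp
  also have "\<dots> = (\<Sum>j\<in>?J. (1 + fps_X ^ (c * (2 * n + 1))) * (t j * fps_X ^ e j)
      + fps_X ^ (a + c * n) * (t (j - 1) * fps_X ^ e (j - 1))
      + fps_X ^ (b + c * n) * (t (j + 1) * fps_X ^ e (j + 1)))"
    by (simp only: sum_distrib_left sum.distrib)
  also have "\<dots> = (\<Sum>j\<in>?J. ((1 - fps_X ^ (c * (2 * n + 1))) * (1 - fps_X ^ (c * (2 * n + 2)))) *
      (I (n + 1 + j) * I (n + 1 - j) * fps_X ^ e j))"
  proof (rule sum.cong)
    fix j assume j: "j \<in> ?J"
    have 1: "fps_X ^ (a + c * n) * (t (j - 1) * fps_X ^ e (j - 1)) =
        t (j - 1) * fps_X ^ (c * nat (n + 1 - j)) * fps_X ^ e j"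
      using arg_cong[OF e_minus[OF j], of "(^) (fps_X :: rat fps)"]
      unfolding power_add by (simp only: ac_simps)
    have 2: "fps_X ^ (b + c * n) * (t (j + 1) * fps_X ^ e (j + 1)) =
        t (j + 1) * fps_X ^ (c * nat (n + 1 + j)) * fps_X ^ e j"
      using arg_cong[OF e_plus[OF j], of "(^) (fps_X :: rat fps)"]
      unfolding power_add by (simp only: ac_simps)
    have "(1 + fps_X ^ (c * (2 * n + 1))) * (t j * fps_X ^ e j)
      + fps_X ^ (a + c * n) * (t (j - 1) * fps_X ^ e (j - 1))
      + fps_X ^ (b + c * n) * (t (j + 1) * fps_X ^ e (j + 1)) =
      (t j * (1 + fps_X ^ (c * (2 * n + 1))) + t (j - 1) * fps_X ^ (c * nat (n + 1 - j))
       + t (j + 1) * fps_X ^ (c * nat (n + 1 + j))) * fps_X ^ e j"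
      unfolding 1 2 by (simp only: ring_distribs ac_simps)
    also have "\<dots> = I (n + 1 + j) * I (n + 1 - j) * ((1 - fps_X ^ (c * (2 * n + 1))) * (1 - fps_X ^ (c * (2 * n + 2))))
        * fps_X ^ e j"
      unfolding t_def I_def using inv_euler_partial_pascal[OF c j] by simp
    finally show "(1 + fps_X ^ (c * (2 * n + 1))) * (t j * fps_X ^ e j)
      + fps_X ^ (a + c * n) * (t (j - 1) * fps_X ^ e (j - 1))
      + fps_X ^ (b + c * n) * (t (j + 1) * fps_X ^ e (j + 1)) =
      ((1 - fps_X ^ (c * (2 * n + 1))) * (1 - fps_X ^ (c * (2 * n + 2)))) *
      (I (n + 1 + j) * I (n + 1 - j) * fps_X ^ e j)"
      by (simp only: ac_simps)
  qed simp
  also have "\<dots> = (1 - fps_X ^ (c * (2 * n + 1))) * (1 - fps_X ^ (c * (2 * n + 2))) * theta_partial a b (Suc n)"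
    unfolding theta_partial_def sum_distrib_left
    by (rule sum.cong) (auto simp: I_def c_def e_def algebra_simps)
  finally show ?thesis by (simp only: c_def)
qed

text \<open>Induction: the factors gained on the left are exchanged by
  \<open>theta_partial_Suc\<close> for the two new factors of \<open>euler_partial\<close>.\<close>

lemma finite_jacobi_triple_product:
  assumes "a + b > 0"
  shows "(\<Prod>k<n. 1 + fps_X ^ (a + (a + b) * k)) * (\<Prod>k<n. 1 + fps_X ^ (b + (a + b) * k))
    = euler_partial (a + b) (2 * n) * theta_partial a b n"
proof (induction n)
  case 0
  show ?case by (simp add: theta_partial_def euler_partial_def inv_euler_partial_def theta_exponent_def)
next
  case (Suc n)
  have E: "euler_partial (a + b) (2 * Suc n) = euler_partial (a + b) (2 * n) *
      ((1 - fps_X ^ ((a + b) * (2 * n + 1))) * (1 - fps_X ^ ((a + b) * (2 * n + 2))))"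
    by (simp add: euler_partial_def del: mult_Suc_right) (simp add: mult.assoc)
  let ?x = "1 + fps_X ^ (a + (a + b) * n) :: rat fps" and ?y = "1 + fps_X ^ (b + (a + b) * n) :: rat fps"
  have "(\<Prod>k<Suc n. 1 + fps_X ^ (a + (a + b) * k)) * (\<Prod>k<Suc n. 1 + fps_X ^ (b + (a + b) * k))
    = (\<Prod>k<n. 1 + fps_X ^ (a + (a + b) * k)) * (\<Prod>k<n. 1 + fps_X ^ (b + (a + b) * k)) * (?x * ?y)"
    by (simp only: prod.lessThan_Suc ac_simps)
  also have "\<dots> = euler_partial (a + b) (2 * n) * (?x * ?y * theta_partial a b n)"
    unfolding Suc.IH by (simp only: ac_simps)
  finally show ?case
    unfolding theta_partial_Suc[OF assms] E by (simp only: ac_simps)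
qed

text \<open>In degree \<open>N\<close> only the finitely many \<open>j\<close> with exponent at most
  \<open>N\<close> contribute, so the limit can be taken term by term.\<close>

lemma tendsto_theta_partial:
  assumes "a + b > 0"
  shows "theta_partial a b \<longlonglongrightarrow> (inverse (euler_f (a + b)))\<^sup>2 * theta a b"
proof (rule tendsto_fpsI)
  fix N
  define c where "c = a + b"
  have c: "c > 0" using assms by (simp add: c_def)
  let ?e = "\<lambda>j. nat (theta_exponent a b j)"
  define J where "J = {j. theta_exponent a b j \<le> int N}"
  have finJ: "finite J" unfolding J_def by (rule finite_theta_exponent_le[OF assms])
  have E0: "fps_nth (euler_f c) 0 = 1"
    by (simp add: euler_f_def)
  have lim: "(\<lambda>n. inv_euler_partial c (f n)) \<longlonglongrightarrow> inverse (euler_f c)"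
    if f: "filterlim (\<lambda>n. nat (f n)) sequentially sequentially" "\<forall>\<^sub>F n in sequentially. f n \<ge> 0" for f :: "nat \<Rightarrow> int"
  proof (rule Lim_transform_eventually)
    have "(\<lambda>n. euler_partial c (nat (f n))) \<longlonglongrightarrow> euler_f c"
      using filterlim_compose[OF tendsto_euler_f[OF c] f(1)] by (simp add: euler_partial_def)
    then show "(\<lambda>n. inverse (euler_partial c (nat (f n)))) \<longlonglongrightarrow> inverse (euler_f c)"
      by (rule tendsto_inverse_fps) (simp add: E0)
    show "\<forall>\<^sub>F n in sequentially. inverse (euler_partial c (nat (f n))) = inv_euler_partial c (f n)"
      using f(2) by eventually_elim (simp add: inv_euler_partial_def)
  qed
  have "(\<lambda>n. inv_euler_partial c (int n + j)) \<longlonglongrightarrow> inverse (euler_f c)" for j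
  proof (rule lim)
    show "filterlim (\<lambda>n. nat (int n + j)) sequentially sequentially"
      unfolding filterlim_at_top eventually_sequentially
    proof
      fix Z show "\<exists>M. \<forall>n\<ge>M. Z \<le> nat (int n + j)"
        by (rule exI[of _ "Z + nat \<bar>j\<bar>"]) auto
    qed
    show "\<forall>\<^sub>F n in sequentially. int n + j \<ge> 0"
      unfolding eventually_sequentially by (rule exI[of _ "nat \<bar>j\<bar>"]) auto
  qed
  \<comment> \<open>The instance at \<open>- j\<close> supplies the limit of the factor with
    argument \<open>n - j\<close>.\<close>
  from this this[of "- _", simplified] have
    "(\<lambda>n. \<Sum>j\<in>J. inv_euler_partial c (int n + j) * inv_euler_partial c (int n - j) * fps_X ^ ?e j) \<longlonglongrightarrow>
     (\<Sum>j\<in>J. inverse (euler_f c) * inverse (euler_f c) * fps_X ^ ?e j)"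
    by (intro tendsto_sum_fps tendsto_mult_fps tendsto_const) simp_all
  then have 1: "\<forall>\<^sub>F n in sequentially.
      fps_nth (\<Sum>j\<in>J. inv_euler_partial c (int n + j) * inv_euler_partial c (int n - j) * fps_X ^ ?e j) N =
      fps_nth (\<Sum>j\<in>J. inverse (euler_f c) * inverse (euler_f c) * fps_X ^ ?e j) N"
    unfolding tendsto_fps_iff by blast
  have 2: "fps_nth (theta_partial a b n) N =
      fps_nth (\<Sum>j\<in>J. inv_euler_partial c (int n + j) * inv_euler_partial c (int n - j) * fps_X ^ ?e j) N" for n
  proof -
    let ?K = "{- int n..int n} \<union> J"
    have "theta_partial a b n = (\<Sum>j\<in>?K. inv_euler_partial c (int n + j) * inv_euler_partial c (int n - j) * fps_X ^ ?e j)"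
      using finJ theta_partial_wider[of n ?K a b] by (simp add: c_def)
    also have "fps_nth \<dots> N = fps_nth (\<Sum>j\<in>J. inv_euler_partial c (int n + j) * inv_euler_partial c (int n - j) * fps_X ^ ?e j) N"
      unfolding fps_sum_nth
      by (rule sum.mono_neutral_right) (use finJ in \<open>auto simp: J_def fps_X_power_mult_right_nth\<close>)
    finally show ?thesis .
  qed
  \<comment> \<open>The sum over \<open>J\<close> agrees with the theta series up to degree
    \<open>N\<close>, which is all that the coefficient of degree \<open>N\<close> of the product
    needs.\<close>
  have 3: "fps_nth (\<Sum>j\<in>J. fps_X ^ ?e j) i = fps_nth (theta a b) i" if "i \<le> N" for i
  proof -
    have "fps_nth (\<Sum>j\<in>J. fps_X ^ ?e j) i = (\<Sum>j\<in>J. if ?e j = i then 1 else 0 :: rat)"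
      by (simp add: fps_sum_nth eq_commute)
    also have "\<dots> = of_nat (card {j\<in>J. ?e j = i})"
      using finJ by (simp flip: sum.inter_filter)
    also have "{j\<in>J. ?e j = i} = {j. theta_exponent a b j = int i}"
      using that theta_exponent_nonneg[of a b] by (auto simp: J_def)
    finally show ?thesis by (simp add: theta_def)
  qed
  have 4: "fps_nth (\<Sum>j\<in>J. inverse (euler_f c) * inverse (euler_f c) * fps_X ^ ?e j) N =
      fps_nth ((inverse (euler_f c))\<^sup>2 * theta a b) N"
    unfolding sum_distrib_left[symmetric] power2_eq_square
    unfolding fps_mult_nth[of "inverse (euler_f c) * inverse (euler_f c)"]
    by (rule sum.cong) (simp_all add: 3)
  show "\<forall>\<^sub>F n in sequentially. fps_nth (theta_partial a b n) N = fps_nth ((inverse (euler_f (a + b)))\<^sup>2 * theta a b) N"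
    using 1 by eventually_elim (simp add: 2 4 flip: c_def)
qed

text \<open>In the limit the right-hand side of the finite identity is
  \<open>f * (1/f)^2 * theta a b\<close> with \<open>f = euler_f (a + b)\<close>; it remains to
  multiply by \<open>f\<close>.\<close>

theorem jacobi_triple_product:
  assumes "a + b > 0"
  shows "theta a b = qprod a (a + b) * qprod b (a + b) * euler_f (a + b)"
proof -
  let ?f = "euler_f (a + b)"
  have f: "inverse ?f * ?f = 1"
    by (rule inverse_mult_eq_1) (simp add: euler_f_def)
  have "(\<lambda>n. euler_partial (a + b) (2 * n)) \<longlonglongrightarrow> ?f"
    using filterlim_compose[OF tendsto_euler_f[OF assms] filterlim_mult_left_nat[of 2]]
    by (simp add: euler_partial_def)
  then have "(\<lambda>n. euler_partial (a + b) (2 * n) * theta_partial a b n) \<longlonglongrightarrow> ?f * ((inverse ?f)\<^sup>2 * theta a b)"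
    by (intro tendsto_mult_fps tendsto_theta_partial assms)
  moreover have "(\<lambda>n. (\<Prod>k<n. 1 + fps_X ^ (a + (a + b) * k)) * (\<Prod>k<n. 1 + fps_X ^ (b + (a + b) * k)))
      \<longlonglongrightarrow> qprod a (a + b) * qprod b (a + b)"
    by (intro tendsto_mult_fps tendsto_qprod assms)
  ultimately have "qprod a (a + b) * qprod b (a + b) = ?f * ((inverse ?f)\<^sup>2 * theta a b)"
    unfolding finite_jacobi_triple_product[OF assms] by (intro LIMSEQ_unique)
  then have "qprod a (a + b) * qprod b (a + b) * ?f = (inverse ?f * ?f) * (inverse ?f * ?f) * theta a b"
    by (simp only: power2_eq_square ac_simps)
  then show ?thesis by (simp add: f)
qed

section \<open>Squares of theta series via cosets of norm 5\<close>

text \<open>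
  The pair $(2 m + n, 2 n - m)$ is $(2 - i)(m + i n)$, and the class of $u + i v$ modulo $2 - i$ is
  determined by $u + 2 v$ modulo 5.
\<close>

lemma card_norm5_cosets:
  fixes F :: "int \<Rightarrow> int \<Rightarrow> int" and u v :: "'b \<Rightarrow> int"
  assumes fin: "finite {(i, j). F i j = N}"
    and R: "bij_betw (\<lambda>r. (u r + 2 * v r) mod 5) R {0..4}"
  shows "card {(i, j). F i j = N} = (\<Sum>r\<in>R. card {(m, n). F (2 * m + n + u r) (2 * n - m + v r) = N})"
proof -
  let ?g = "\<lambda>r (m, n). (2 * m + n + u r, 2 * n - m + v r)"
  let ?A = "{(i, j). F i j = N}"
  let ?B = "\<lambda>r. {(m, n). F (2 * m + n + u r) (2 * n - m + v r) = N}"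
  have inj: "inj_on (?g r) X" for r X
    by (auto simp: inj_on_def)
  have sub: "?g r ` ?B r \<subseteq> ?A" for r
    by auto
  have fin_R: "finite R" using bij_betw_finite[OF R] by simp
  \<comment> \<open>\<open>(2 m + n) + 2 (2 n - m) = 5 n\<close>, so the residue is constant on a
    coset and the cosets are disjoint.\<close>
  have residue: "(fst x + 2 * snd x) mod 5 = (u r + 2 * v r) mod 5" if "x = ?g r y" for x r y
  proof -
    have "fst x + 2 * snd x = u r + 2 * v r + 5 * snd y"
      using that by (cases y) simp
    then show ?thesis by simp
  qed
  have "?A \<subseteq> (\<Union>r\<in>R. ?g r ` ?B r)"
  proof
    fix x assume x: "x \<in> ?A"
    obtain i j where ij: "x = (i, j)" by (cases x)
    have "(i + 2 * j) mod 5 \<in> (\<lambda>r. (u r + 2 * v r) mod 5) ` R"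
      using bij_betw_imp_surj_on[OF R] by simp
    then obtain r where r: "r \<in> R" "(i + 2 * j) mod 5 = (u r + 2 * v r) mod 5" by auto
    then have "5 dvd (i + 2 * j) - (u r + 2 * v r)" by (simp only: mod_eq_dvd_iff)
    then obtain n where n: "(i + 2 * j) - (u r + 2 * v r) = 5 * n" by (elim dvdE)
    \<comment> \<open>The second coordinate is solved for \<open>m\<close>; the first is then
      correct by the choice of \<open>n\<close>.\<close>
    define m where "m = 2 * n - (j - v r)"
    have g: "2 * m + n + u r = i" "2 * n - m + v r = j" using n by (simp_all add: m_def)
    then have "(m, n) \<in> ?B r" "x = ?g r (m, n)" using x by (simp_all only: ij g mem_Collect_eq case_prod_conv)
    then show "x \<in> (\<Union>r\<in>R. ?g r ` ?B r)" using r(1) by blast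
  qed
  then have "?A = (\<Union>r\<in>R. ?g r ` ?B r)" using sub by blast
  then have "card ?A = card (\<Union>r\<in>R. ?g r ` ?B r)" by (rule arg_cong)
  also have " \<dots> = (\<Sum>r\<in>R. card (?g r ` ?B r))"
  proof (rule card_UN_disjoint)
    show "\<forall>r\<in>R. finite (?g r ` ?B r)" using finite_subset[OF sub fin] by blast
    show "\<forall>r\<in>R. \<forall>s\<in>R. r \<noteq> s \<longrightarrow> ?g r ` ?B r \<inter> ?g s ` ?B s = {}"
    proof (intro ballI impI equals0I)
      fix r s x assume rs: "r \<in> R" "s \<in> R" "r \<noteq> s" "x \<in> ?g r ` ?B r \<inter> ?g s ` ?B s"
      then obtain y z where "x = ?g r y" "x = ?g s z" by blast
      then have "(u r + 2 * v r) mod 5 = (u s + 2 * v s) mod 5"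
        using residue[of x r y] residue[of x s z] by (simp only:)
      then show False
        using inj_onD[OF bij_betw_imp_inj_on[OF R]] rs by blast
    qed
  qed fact
  also have "\<dots> = (\<Sum>r\<in>R. card (?B r))"
    using card_image[OF inj] by (simp only:)
  finally show ?thesis .
qed

text \<open>Doubling removes the divisions and leaves a polynomial identity; hence the
  \<open>2 * k\<close>.\<close>

lemma theta_exponent_eqI:
  assumes "(int a + int b) * x\<^sup>2 + (int a - int b) * x + (int c + int d) * y\<^sup>2 + (int c - int d) * y =
    (int a' + int b') * z\<^sup>2 + (int a' - int b') * z + (int c' + int d') * w\<^sup>2 + (int c' - int d') * w + 2 * k"
  shows "theta_exponent a b x + theta_exponent c d y = theta_exponent a' b' z + theta_exponent c' d' w + k"
  using assms double_theta_exponent[of a b x] double_theta_exponent[of c d y]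
    double_theta_exponent[of a' b' z] double_theta_exponent[of c' d' w] by linarith

lemma card_theta_exponent_shift:
  assumes "a + b > 0" "c + d > 0"
  shows "of_nat (card {(m, n). theta_exponent a b m + theta_exponent c d n + int k = int N}) =
    fps_nth (fps_X ^ k * (theta a b * theta c d)) N"
proof (cases "k \<le> N")
  case True
  then have "{(m, n). theta_exponent a b m + theta_exponent c d n + int k = int N} =
      {(m, n). theta_exponent a b m + theta_exponent c d n = int (N - k)}"
    by auto
  then show ?thesis
    using True nth_theta_mult[OF assms] by (simp add: fps_X_power_mult_nth)
next
  case False
  then have "{(m, n). theta_exponent a b m + theta_exponent c d n + int k = int N} = {}"
  proof -
    have "theta_exponent a b m + theta_exponent c d n + int k \<noteq> int N" for m n
      using False theta_exponent_nonneg[of a b m] theta_exponent_nonneg[of c d n] by linarith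
    then show ?thesis by blast
  qed
  then show ?thesis using False by (simp add: fps_X_power_mult_nth)
qed

text \<open>Multiplication by \<open>2 - i\<close> scales \<open>m^2 + n^2\<close> by 5 and creates
  no mixed term, so on each coset the exponent can separate into a part in \<open>m\<close>, a part
  in \<open>n\<close> and a constant. An element of \<open>S\<close> lists the representative
  \<open>(u, v)\<close>, the parameters of the two resulting theta series and the constant
  \<open>k\<close>.\<close>

lemma theta_square_norm5:
  assumes ab: "a + b > 0"
    and S: "bij_betw (\<lambda>(u, v, _). (u + 2 * v) mod 5) S {0..4}"
    and exp: "\<And>u v c d c' d' k m n. (u, v, c, d, c', d', k) \<in> S \<Longrightarrow>
      theta_exponent a b (2 * m + n + u) + theta_exponent a b (2 * n - m + v) =
      theta_exponent c d m + theta_exponent c' d' n + int k"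
    and pos: "\<And>u v c d c' d' k. (u, v, c, d, c', d', k) \<in> S \<Longrightarrow> c + d > 0 \<and> c' + d' > 0"
  shows "theta a b ^ 2 = (\<Sum>(u, v, c, d, c', d', k)\<in>S. fps_X ^ k * (theta c d * theta c' d'))"
proof (rule fps_ext)
  fix N
  let ?G = "\<lambda>i j. theta_exponent a b i + theta_exponent a b j"
  let ?u = "\<lambda>s. fst s" and ?v = "\<lambda>s. fst (snd s)"
  have "fps_nth (theta a b ^ 2) N = of_nat (card {(i, j). ?G i j = int N})"
    unfolding power2_eq_square by (rule nth_theta_mult[OF ab ab])
  also have "card {(i, j). ?G i j = int N} =
      (\<Sum>s\<in>S. card {(m, n). ?G (2 * m + n + ?u s) (2 * n - m + ?v s) = int N})"
    using S by (intro card_norm5_cosets finite_theta_exponent_pairs ab) (simp add: case_prod_unfold)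
  also have "of_nat \<dots> = (\<Sum>(u, v, c, d, c', d', k)\<in>S. fps_nth (fps_X ^ k * (theta c d * theta c' d')) N)"
    unfolding of_nat_sum
  proof (rule sum.cong)
    fix s assume "s \<in> S"
    then obtain u v c d c' d' k where s: "s = (u, v, c, d, c', d', k)" "(u, v, c, d, c', d', k) \<in> S"
      by (cases s) auto
    show "of_nat (card {(m, n). ?G (2 * m + n + ?u s) (2 * n - m + ?v s) = int N}) =
      (case s of (u, v, c, d, c', d', k) \<Rightarrow> fps_nth (fps_X ^ k * (theta c d * theta c' d')) N)"
      using card_theta_exponent_shift[of c d c' d' k N] pos[OF s(2)]
      by (simp add: s(1) exp[OF s(2)])
  qed simp
  finally show "fps_nth (theta a b ^ 2) N =
      fps_nth (\<Sum>(u, v, c, d, c', d', k)\<in>S. fps_X ^ k * (theta c d * theta c' d')) N"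
    by (simp add: fps_sum_nth case_prod_unfold)
qed

lemma atLeastAtMost_0_4_int: "{0..4::int} = {0, 1, 2, 3, 4}"
  by auto

text \<open>The cosets are represented by 0 and the units 1, i, -1, -i. Rotation by i permutes the
  units, so their four cosets give the same product.\<close>

lemma theta_1_1_square:
  "theta 1 1 ^ 2 = theta 5 5 ^ 2 + 4 * (fps_X * (theta 9 1 * theta 7 3))"
proof -
  let ?S = "{(0, 0, 5, 5, 5, 5, 0), (1, 0, 9, 1, 7, 3, 1), (0, 1, 3, 7, 9, 1, 1),
    (- 1, 0, 1, 9, 3, 7, 1), (0, - 1, 7, 3, 1, 9, 1)} :: (int \<times> int \<times> nat \<times> nat \<times> nat \<times> nat \<times> nat) set"
  have "theta 1 1 ^ 2 = (\<Sum>(u, v, c, d, c', d', k)\<in>?S. fps_X ^ k * (theta c d * theta c' d'))"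
  proof (rule theta_square_norm5)
    show "bij_betw (\<lambda>(u, v, _). (u + 2 * v) mod 5) ?S {0..4}"
      unfolding bij_betw_def atLeastAtMost_0_4_int by auto
    show "theta_exponent 1 1 (2 * m + n + u) + theta_exponent 1 1 (2 * n - m + v) =
      theta_exponent c d m + theta_exponent c' d' n + int k"
      if "(u, v, c, d, c', d', k) \<in> ?S" for u v c d c' d' k m n
      using that by (intro theta_exponent_eqI) (auto simp: algebra_simps power2_eq_square)
  qed auto
  also have "\<dots> = theta 5 5 * theta 5 5 + (fps_X * (theta 9 1 * theta 7 3) + (fps_X * (theta 3 7 * theta 9 1)
      + (fps_X * (theta 1 9 * theta 3 7) + fps_X * (theta 7 3 * theta 1 9))))"
    by simp
  also have "\<dots> = theta 5 5 ^ 2 + 4 * (fps_X * (theta 9 1 * theta 7 3))"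
    unfolding theta_commute[of 3 7] theta_commute[of 1 9] by algebra
  finally show ?thesis .
qed

text \<open>Here \<open>theta 0 1\<close> is \<open>2 psi(q)\<close>, each triangular number being
  hit twice. The exponent is symmetric about \<open>(1 + i)/2\<close>; the corners 0, 1, i, 1 + i of
  the unit square around this point give equal products, and the fifth coset is that of 2 +
  i.\<close>

lemma theta_0_1_square:
  "theta 0 1 ^ 2 = 4 * (theta 1 4 * theta 2 3) + fps_X * theta 0 5 ^ 2"
proof -
  let ?S = "{(0, 0, 2, 3, 1, 4, 0), (1, 0, 4, 1, 2, 3, 0), (0, 1, 1, 4, 3, 2, 0),
    (1, 1, 3, 2, 4, 1, 0), (2, 1, 5, 0, 5, 0, 1)} :: (int \<times> int \<times> nat \<times> nat \<times> nat \<times> nat \<times> nat) set"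
  have "theta 0 1 ^ 2 = (\<Sum>(u, v, c, d, c', d', k)\<in>?S. fps_X ^ k * (theta c d * theta c' d'))"
  proof (rule theta_square_norm5)
    show "bij_betw (\<lambda>(u, v, _). (u + 2 * v) mod 5) ?S {0..4}"
      unfolding bij_betw_def atLeastAtMost_0_4_int by auto
    show "theta_exponent 0 1 (2 * m + n + u) + theta_exponent 0 1 (2 * n - m + v) =
      theta_exponent c d m + theta_exponent c' d' n + int k"
      if "(u, v, c, d, c', d', k) \<in> ?S" for u v c d c' d' k m n
      using that by (intro theta_exponent_eqI) (auto simp: algebra_simps power2_eq_square)
  qed auto
  also have "\<dots> = theta 2 3 * theta 1 4 + (theta 4 1 * theta 2 3 + (theta 1 4 * theta 3 2
      + (theta 3 2 * theta 4 1 + fps_X * (theta 5 0 * theta 5 0))))"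
    by simp
  also have "\<dots> = 4 * (theta 1 4 * theta 2 3) + fps_X * theta 0 5 ^ 2"
    unfolding theta_commute[of 3 2] theta_commute[of 4 1] theta_commute[of 5 0] by algebra
  finally show ?thesis .
qed

section \<open>Two relations between Euler products\<close>

abbreviation dilate :: "rat fls \<Rightarrow> rat fls" where
  "dilate F \<equiv> fls_compose_power F 2"

definition reflect :: "rat fls \<Rightarrow> rat fls" where
  "reflect F = fls_compose_fps F (fps_const (- 1) * fps_X)"

lemma tendsto_dilate_fps:
  fixes f :: "nat \<Rightarrow> rat fps"
  assumes "f \<longlonglongrightarrow> a"
  shows "(\<lambda>n. f n oo fps_X ^ 2) \<longlonglongrightarrow> (a oo fps_X ^ 2)"
  using assms by (simp add: tendsto_fps_iff fps_nth_compose_X_power)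

lemma tendsto_reflect_fps:
  fixes f :: "nat \<Rightarrow> rat fps"
  assumes "f \<longlonglongrightarrow> a"
  shows "(\<lambda>n. f n oo (fps_const (- 1) * fps_X)) \<longlonglongrightarrow> (a oo (fps_const (- 1) * fps_X))"
  unfolding tendsto_fps_iff
proof
  fix n
  have "\<forall>\<^sub>F x in sequentially. fps_nth (f x) n = fps_nth a n"
    using assms by (simp add: tendsto_fps_iff)
  then show "\<forall>\<^sub>F x in sequentially. fps_nth (f x oo (fps_const (- 1) * fps_X)) n =
      fps_nth (a oo (fps_const (- 1) * fps_X)) n"
    by eventually_elim (simp only: fps_nth_compose_linear)
qed

lemma dilate_euler_f:
  assumes "m > 0"
  shows "euler_f m oo fps_X ^ 2 = euler_f (2 * m)"
proof (rule LIMSEQ_unique)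
  show "(\<lambda>n. (\<Prod>k<n. 1 - fps_X ^ (m * Suc k)) oo fps_X ^ 2) \<longlonglongrightarrow> (euler_f m oo fps_X ^ 2)"
    by (intro tendsto_dilate_fps tendsto_euler_f assms)
  have "(\<Prod>k<n. 1 - fps_X ^ (m * Suc k)) oo fps_X ^ 2 = (\<Prod>k<n. 1 - fps_X ^ (2 * m * Suc k) :: rat fps)" for n
    by (simp add: fps_compose_prod_distrib fps_compose_sub_distrib fps_compose_power[symmetric]
        power_mult[symmetric] mult.assoc fps_X_fps_compose_startby0 del: mult_Suc_right)
  then show "(\<lambda>n. (\<Prod>k<n. 1 - fps_X ^ (m * Suc k)) oo fps_X ^ 2) \<longlonglongrightarrow> euler_f (2 * m)"
    using tendsto_euler_f[of "2 * m"] assms by simp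
qed

lemma reflect_one_minus_X_power:
  "(1 - fps_X ^ n) oo (fps_const (- 1) * fps_X) = 1 - (- 1) ^ n * (fps_X ^ n :: rat fps)"
  by (simp add: fps_compose_sub_distrib fps_compose_power[symmetric] fps_X_fps_compose_startby0
      power_mult_distrib fps_const_neg[symmetric] flip: power_minus)

lemma reflect_euler_f_even:
  assumes "m > 0" "even m"
  shows "euler_f m oo (fps_const (- 1) * fps_X) = euler_f m"
proof (rule LIMSEQ_unique)
  show "(\<lambda>n. (\<Prod>k<n. 1 - fps_X ^ (m * Suc k)) oo (fps_const (- 1) * fps_X)) \<longlonglongrightarrow>
      (euler_f m oo (fps_const (- 1) * fps_X))"
    by (intro tendsto_reflect_fps tendsto_euler_f assms)
  show "(\<lambda>n. (\<Prod>k<n. 1 - fps_X ^ (m * Suc k)) oo (fps_const (- 1) * fps_X)) \<longlonglongrightarrow> euler_f m"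
    using tendsto_euler_f[OF assms(1)] assms(2)
    by (simp add: fps_compose_prod_distrib reflect_one_minus_X_power del: mult_Suc_right)
qed

text \<open>For odd \<open>m\<close> the factors at odd multiples of \<open>m\<close> change sign
  and those at even multiples do not. Partial products with \<open>2 * n\<close> factors contain
  equally many of both.\<close>

lemma reflect_euler_f_odd:
  assumes "odd m"
  shows "euler_f m oo (fps_const (- 1) * fps_X) = qprod m (2 * m) * euler_f (2 * m)"
proof (rule LIMSEQ_unique)
  have m: "m > 0" using assms by (rule odd_pos)
  have "(\<lambda>n. (\<Prod>k<2 * n. 1 - fps_X ^ (m * Suc k)) oo (fps_const (- 1) * fps_X)) \<longlonglongrightarrow>
      (euler_f m oo (fps_const (- 1) * fps_X))"
    by (intro tendsto_reflect_fps filterlim_compose[OF tendsto_euler_f[OF m] filterlim_mult_left_nat]) simp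
  moreover have "(\<Prod>k<2 * n. 1 - fps_X ^ (m * Suc k)) oo (fps_const (- 1) * fps_X) =
      (\<Prod>k<n. 1 + fps_X ^ (m + 2 * m * k)) * (\<Prod>k<n. 1 - fps_X ^ (2 * m * Suc k) :: rat fps)" for n
  proof -
    have "(\<Prod>k<2 * n. 1 - fps_X ^ (m * Suc k)) oo (fps_const (- 1) * fps_X) =
        (\<Prod>k<2 * n. 1 - (- 1) ^ (m * Suc k) * fps_X ^ (m * Suc k) :: rat fps)"
      by (simp add: fps_compose_prod_distrib reflect_one_minus_X_power del: mult_Suc_right)
    also have "\<dots> = (\<Prod>k<n. 1 - (- 1) ^ (m * Suc (2 * k)) * fps_X ^ (m * Suc (2 * k))) *
        (\<Prod>k<n. 1 - (- 1) ^ (m * Suc (Suc (2 * k))) * fps_X ^ (m * Suc (Suc (2 * k))))"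
      unfolding prod_lessThan_mult by (simp add: lessThan_nat_numeral del: mult_Suc_right)
    also have "\<dots> = (\<Prod>k<n. 1 + fps_X ^ (m + 2 * m * k)) * (\<Prod>k<n. 1 - fps_X ^ (2 * m * Suc k))"
      using assms by (intro arg_cong2[of _ _ _ _ "(*)"] prod.cong) (auto simp: algebra_simps)
    finally show ?thesis .
  qed
  ultimately show "(\<lambda>n. (\<Prod>k<n. 1 + fps_X ^ (m + 2 * m * k)) * (\<Prod>k<n. 1 - fps_X ^ (2 * m * Suc k))) \<longlonglongrightarrow>
      (euler_f m oo (fps_const (- 1) * fps_X))"
    by simp
  show "(\<lambda>n. (\<Prod>k<n. 1 + fps_X ^ (m + 2 * m * k)) * (\<Prod>k<n. 1 - fps_X ^ (2 * m * Suc k))) \<longlonglongrightarrow>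
      qprod m (2 * m) * euler_f (2 * m)"
    using m by (intro tendsto_mult_fps tendsto_qprod tendsto_euler_f) auto
qed

lemma fL_nonzero [simp]: "fL m \<noteq> 0"
proof -
  have "fps_nth (euler_f m) 0 = 1" by (simp add: euler_f_def)
  then have "euler_f m \<noteq> 0" by auto
  then show ?thesis by (simp add: fL_def)
qed

lemma dilate_divide [simp]: "dilate (F / G) = dilate F / dilate G"
proof (cases "G = 0")
  case False
  have "dilate (F / G) * dilate G = dilate F"
    using False by (simp flip: fls_compose_power_mult)
  moreover have "dilate G \<noteq> 0"
  proof
    assume "dilate G = 0"
    then have "dilate (G * inverse G) = 0" by (simp only: fls_compose_power_mult mult_zero_left)
    then show False using False by simp
  qed
  ultimately show ?thesis by (simp add: field_simps)
qed simp

lemma dilate_fL: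
  assumes "m > 0"
  shows "dilate (fL m) = fL (2 * m)"
  using dilate_euler_f[OF assms] by (simp add: fL_def fls_compose_power_fps_to_fls)

lemma dilate_numeral: "dilate (numeral n) = numeral n"
  using fls_compose_power_const_left[of 2 "numeral n :: rat"] by simp

lemma dilate_X [simp]: "dilate fls_X = fls_X ^ 2"
  by (simp add: fls_X_power_conv_shift_1)

lemma reflect_X [simp]: "reflect fls_X = - fls_X"
  by (simp add: reflect_def flip: fps_const_neg)

lemma reflection_arg: "fps_const (- 1) * fps_X \<noteq> (0 :: rat fps)" "fps_nth (fps_const (- 1) * fps_X :: rat fps) 0 = 0"
  by simp_all

lemma reflect_mult: "reflect (F * G) = reflect F * reflect G"
  and reflect_divide: "reflect (F / G) = reflect F / reflect G"
  and reflect_add: "reflect (F + G) = reflect F + reflect G"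
  and reflect_power: "reflect (F ^ n) = reflect F ^ n"
  unfolding reflect_def
  by (rule fls_compose_fps_mult fls_compose_fps_divide fls_compose_fps_add fls_compose_fps_power;
      rule reflection_arg)+

lemma reflect_numeral: "reflect (numeral n) = numeral n"
  unfolding reflect_def using fls_compose_fps_of_nat[of "numeral n"] by simp

lemmas reflect_simps = reflect_mult reflect_divide reflect_add reflect_power reflect_numeral reflect_X

lemma reflect_fL_even: "m > 0 \<Longrightarrow> even m \<Longrightarrow> reflect (fL m) = fL m"
  using reflect_euler_f_even[of m] reflection_arg by (simp add: reflect_def fL_def)

lemma qprod_eq_fL:
  assumes "m > 0"
  shows "fps_to_fls (qprod m m) = fL (2 * m) / fL m"
  using qprod_mult_euler_f[OF assms] fL_nonzero[of m]
  by (simp add: fL_def field_simps flip: fls_times_fps_to_fls)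

text \<open>The product over odd multiples of \<open>m\<close> is the product over all multiples
  divided by that over even multiples.\<close>

lemma qprod_double_eq_fL:
  assumes "m > 0"
  shows "fps_to_fls (qprod m (2 * m)) = fL (2 * m) ^ 2 / (fL m * fL (4 * m))"
proof -
  have "qprod m m = qprod m (2 * m) * qprod (2 * m) (2 * m)"
    using qprod_split[OF assms, of 2 m] by (simp add: numeral_2_eq_2)
  then have "fps_to_fls (qprod m m) = fps_to_fls (qprod m (2 * m)) * fps_to_fls (qprod (2 * m) (2 * m))"
    by (simp add: fls_times_fps_to_fls)
  then have "fL (2 * m) / fL m = fps_to_fls (qprod m (2 * m)) * (fL (4 * m) / fL (2 * m))"
    using assms by (simp add: qprod_eq_fL)
  then show ?thesis by (simp add: field_simps power2_eq_square)
qed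

text \<open>Thus \<open>q -> -q\<close> maps quotients of Euler products to quotients of Euler
  products, and \<open>u(-q)\<close> can be compared with \<open>u(q)\<close> by exponents
  alone.\<close>

lemma reflect_fL_odd:
  assumes "odd m"
  shows "reflect (fL m) = fL (2 * m) ^ 3 / (fL m * fL (4 * m))"
proof -
  have "reflect (fL m) = fps_to_fls (qprod m (2 * m)) * fL (2 * m)"
    using reflect_euler_f_odd[OF assms] reflection_arg by (simp add: reflect_def fL_def fls_times_fps_to_fls)
  then show ?thesis
    using odd_pos[OF assms] by (simp add: qprod_double_eq_fL power2_eq_square power3_eq_cube)
qed

text \<open>The identity for $\varphi(q)^2 - \varphi(q^5)^2$, as $\varphi(q) = f_2^5/(f_1 f_4)^2$.\<close>

lemma euler_relation_1_2_5_10_20: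
  "fL 2 ^ 10 / (fL 1 * fL 4) ^ 4 =
    fL 10 ^ 10 / (fL 5 * fL 20) ^ 4 + 4 * fls_X * (fL 2 ^ 2 * fL 5 * fL 20 / (fL 1 * fL 4))"
proof -
  define Q where "Q a c = fps_to_fls (qprod a c)" for a c
  have th: "fps_to_fls (theta a b) = Q a (a + b) * Q b (a + b) * fL (a + b)" if "a + b > 0" for a b
    using jacobi_triple_product[OF that] by (simp add: Q_def fL_def fls_times_fps_to_fls)
  have Q1: "Q 1 2 = fL 2 ^ 2 / (fL 1 * fL 4)" and Q5: "Q 5 10 = fL 10 ^ 2 / (fL 5 * fL 20)"
    using qprod_double_eq_fL[of 1] qprod_double_eq_fL[of 5] by (simp_all add: Q_def)
  \<comment> \<open>The odd exponents are split modulo 10. The classes other than 5 are exactly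
    those occurring in \<open>theta 9 1 * theta 7 3\<close>.\<close>
  have "qprod 1 2 = qprod 1 10 * qprod 3 10 * qprod 5 10 * qprod 7 10 * qprod 9 10"
    using qprod_split[of 2 5 1] by (simp add: lessThan_nat_numeral eval_nat_numeral ac_simps)
  then have split: "Q 1 2 = Q 1 10 * Q 3 10 * Q 5 10 * Q 7 10 * Q 9 10"
    by (simp add: Q_def fls_times_fps_to_fls)
  have "fps_to_fls (theta 1 1) ^ 2 = fps_to_fls (theta 5 5) ^ 2 +
      4 * (fls_X * (fps_to_fls (theta 9 1) * fps_to_fls (theta 7 3)))"
    using arg_cong[OF theta_1_1_square, of fps_to_fls]
    by (simp add: fls_times_fps_to_fls fps_to_fls_power)
  also have "fps_to_fls (theta 9 1) * fps_to_fls (theta 7 3) =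
      (Q 1 10 * Q 3 10 * Q 7 10 * Q 9 10) * fL 10 ^ 2"
    using th[of 9 1] th[of 7 3] by (simp add: power2_eq_square)
  also have "Q 1 10 * Q 3 10 * Q 7 10 * Q 9 10 = Q 1 2 / Q 5 10"
    unfolding split by (simp add: Q5)
  finally have "(Q 1 2 * Q 1 2 * fL 2) ^ 2 = (Q 5 10 * Q 5 10 * fL 10) ^ 2 +
      4 * (fls_X * (Q 1 2 / Q 5 10 * fL 10 ^ 2))"
    using th[of 1 1] th[of 5 5] by (simp only: one_add_one numeral_plus_numeral add_num_simps)
  moreover have "(Q 1 2 * Q 1 2 * fL 2) ^ 2 = fL 2 ^ 10 / (fL 1 * fL 4) ^ 4"
    unfolding Q1 by (simp add: field_simps eval_nat_numeral)
  moreover have "(Q 5 10 * Q 5 10 * fL 10) ^ 2 = fL 10 ^ 10 / (fL 5 * fL 20) ^ 4"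
    unfolding Q5 by (simp add: field_simps eval_nat_numeral)
  moreover have "4 * (fls_X * (Q 1 2 / Q 5 10 * fL 10 ^ 2)) =
      4 * fls_X * (fL 2 ^ 2 * fL 5 * fL 20 / (fL 1 * fL 4))"
    unfolding Q1 Q5 by (simp add: field_simps eval_nat_numeral)
  ultimately show ?thesis by simp
qed

lemma four_mult_cancel_fls: "4 * x = 4 * y \<Longrightarrow> x = (y :: rat fls)"
  by simp

text \<open>The identity for $\psi(q)^2 - q \psi(q^5)^2$, as $\psi(q) = f_2^2/f_1$.\<close>

lemma euler_relation_1_2_5_10:
  "fL 2 ^ 4 / fL 1 ^ 2 = fL 2 * fL 5 ^ 3 / (fL 1 * fL 10) + fls_X * (fL 10 ^ 4 / fL 5 ^ 2)"
proof -
  define Q where "Q a c = fps_to_fls (qprod a c)" for a c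
  have th: "fps_to_fls (theta a b) = Q a (a + b) * Q b (a + b) * fL (a + b)" if "a + b > 0" for a b
    using jacobi_triple_product[OF that] by (simp add: Q_def fL_def fls_times_fps_to_fls)
  have Q1: "Q 1 1 = fL 2 / fL 1" and Q5: "Q 5 5 = fL 10 / fL 5"
    using qprod_eq_fL[of 1] qprod_eq_fL[of 5] by (simp_all add: Q_def)
  \<comment> \<open>After squaring, this 2 gives every term of the relation the factor 4 that is
    cancelled at the end.\<close>
  have Q0: "Q 0 1 = 2 * Q 1 1" "Q 0 5 = 2 * Q 5 5"
    using qprod_0[of 1] qprod_0[of 5] by (simp_all add: Q_def fls_times_fps_to_fls)
  have "qprod 1 1 = qprod 1 5 * qprod 2 5 * qprod 3 5 * qprod 4 5 * qprod 5 5"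
    using qprod_split[of 1 5 1] by (simp add: lessThan_nat_numeral eval_nat_numeral ac_simps)
  then have split: "Q 1 1 = Q 1 5 * Q 2 5 * Q 3 5 * Q 4 5 * Q 5 5"
    by (simp add: Q_def fls_times_fps_to_fls)
  have "fps_to_fls (theta 0 1) ^ 2 =
      4 * (fps_to_fls (theta 1 4) * fps_to_fls (theta 2 3)) + fls_X * fps_to_fls (theta 0 5) ^ 2"
    using arg_cong[OF theta_0_1_square, of fps_to_fls]
    by (simp add: fls_times_fps_to_fls fps_to_fls_power)
  also have "fps_to_fls (theta 1 4) * fps_to_fls (theta 2 3) =
      (Q 1 5 * Q 2 5 * Q 3 5 * Q 4 5) * fL 5 ^ 2"
    using th[of 1 4] th[of 2 3] by (simp add: power2_eq_square)
  also have "Q 1 5 * Q 2 5 * Q 3 5 * Q 4 5 = Q 1 1 / Q 5 5"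
    unfolding split by (simp add: Q5)
  finally have rel: "(2 * Q 1 1 * Q 1 1 * fL 1) ^ 2 =
      4 * (Q 1 1 / Q 5 5 * fL 5 ^ 2) + fls_X * (2 * Q 5 5 * Q 5 5 * fL 5) ^ 2"
    using th[of 0 1] th[of 0 5] by (simp only: Q0 add_0)
  have psi1: "(2 * Q 1 1 * Q 1 1 * fL 1) ^ 2 = 4 * (fL 2 ^ 4 / fL 1 ^ 2)"
    unfolding Q1 by (simp add: field_simps eval_nat_numeral)
  have psi5: "(2 * Q 5 5 * Q 5 5 * fL 5) ^ 2 = 4 * (fL 10 ^ 4 / fL 5 ^ 2)"
    unfolding Q5 by (simp add: field_simps eval_nat_numeral)
  have quot: "Q 1 1 / Q 5 5 * fL 5 ^ 2 = fL 2 * fL 5 ^ 3 / (fL 1 * fL 10)"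
    unfolding Q1 Q5 by (simp add: field_simps eval_nat_numeral)
  have cancel: "x = y + q * z" if "4 * x = 4 * y + q * (4 * z)" for q x y z :: "rat fls"
    by (rule four_mult_cancel_fls) (simp add: that distrib_left mult.left_commute)
  show ?thesis
    by (rule cancel) (rule rel[unfolded psi1 psi5 quot])
qed

section \<open>Even parts of the level 5 forms\<close>

definition hauptmodul :: "rat fls" where
  "hauptmodul = fL 1 ^ 3 * fL 5 / (fls_X * fL 2 * fL 10 ^ 3)"

text \<open>This and \<open>hauptmodul5\<close> are the eta quotients for \<open>u + 4\<close> and
  \<open>u + 5\<close>. The product form is needed for comparing exponents; the equalities are
  proved below.\<close>

definition hauptmodul4 :: "rat fls" where
  "hauptmodul4 = fL 2 * fL 5 ^ 5 / (fls_X * fL 1 * fL 10 ^ 5)"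

definition hauptmodul5 :: "rat fls" where
  "hauptmodul5 = fL 2 ^ 4 * fL 5 ^ 2 / (fls_X * fL 1 ^ 2 * fL 10 ^ 4)"

lemma reflect_fL_1: "reflect (fL 1) = fL 2 ^ 3 / (fL 1 * fL 4)"
  using reflect_fL_odd[of 1] by simp

lemma reflect_fL_5: "reflect (fL 5) = fL 10 ^ 3 / (fL 5 * fL 20)"
  using reflect_fL_odd[of 5] by simp

lemma reflect_fL_2_4_10_20:
  "reflect (fL 2) = fL 2" "reflect (fL 4) = fL 4" "reflect (fL 10) = fL 10" "reflect (fL 20) = fL 20"
  by (rule reflect_fL_even; simp)+

lemmas reflect_fL = reflect_fL_1 reflect_fL_5 reflect_fL_2_4_10_20

lemma dilate_fL_1_2_5_10:
  "dilate (fL 1) = fL 2" "dilate (fL 2) = fL 4" "dilate (fL 5) = fL 10" "dilate (fL 10) = fL 20"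
  using dilate_fL[of 1] dilate_fL[of 2] dilate_fL[of 5] dilate_fL[of 10] by simp_all

lemma dilate_power: "dilate (F ^ n) = dilate F ^ n"
  by simp

lemmas dilate_simps = fls_compose_power_mult dilate_divide fls_compose_power_add dilate_power
  dilate_numeral dilate_X dilate_fL_1_2_5_10

text \<open>Under \<open>q -> -q\<close> the squares of \<open>phi(q)\<close> and
  \<open>phi(q^5)\<close> become \<open>f_1^4 / f_2^2\<close> and \<open>f_5^4 / f_10^2\<close>, so
  \<open>f_4\<close> and \<open>f_20\<close> disappear from the relation.\<close>

lemma hauptmodul4_eq: "hauptmodul4 = hauptmodul + 4"
proof -
  have refl: "fL 2 ^ 10 / (reflect (fL 1) * fL 4) ^ 4 =
      fL 10 ^ 10 / (reflect (fL 5) * fL 20) ^ 4 +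
      4 * (- fls_X) * (fL 2 ^ 2 * reflect (fL 5) * fL 20 / (reflect (fL 1) * fL 4))"
    using arg_cong[OF euler_relation_1_2_5_10_20, of reflect]
    by (simp only: reflect_simps reflect_fL_2_4_10_20)
  have phi1: "fL 2 ^ 10 / (reflect (fL 1) * fL 4) ^ 4 = fL 1 ^ 4 / fL 2 ^ 2"
    unfolding reflect_fL by (simp add: field_simps eval_nat_numeral)
  have phi5: "fL 10 ^ 10 / (reflect (fL 5) * fL 20) ^ 4 = fL 5 ^ 4 / fL 10 ^ 2"
    unfolding reflect_fL by (simp add: field_simps eval_nat_numeral)
  have quot: "fL 2 ^ 2 * reflect (fL 5) * fL 20 / (reflect (fL 1) * fL 4) =
      fL 1 * fL 10 ^ 3 / (fL 2 * fL 5)"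
    unfolding reflect_fL by (simp add: field_simps eval_nat_numeral)
  have swap: "z = y + 4 * x * w" if "y = z + 4 * (- x) * w" for w x y z :: "rat fls"
    using that by simp
  have rel: "fL 5 ^ 4 / fL 10 ^ 2 = fL 1 ^ 4 / fL 2 ^ 2 + 4 * fls_X * (fL 1 * fL 10 ^ 3 / (fL 2 * fL 5))"
    by (rule swap) (rule refl[unfolded phi1 phi5 quot])
  \<comment> \<open>The cofactor of 4 in \<open>rel\<close>; dividing by it turns that term into the
    constant 4.\<close>
  let ?d = "fls_X * fL 1 * fL 10 ^ 3 / (fL 2 * fL 5)"
  have "hauptmodul4 = fL 5 ^ 4 / fL 10 ^ 2 / ?d"
    unfolding hauptmodul4_def by (simp add: field_simps eval_nat_numeral)
  also have "\<dots> = fL 1 ^ 4 / fL 2 ^ 2 / ?d + 4"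
    unfolding rel by (simp add: field_simps)
  also have "fL 1 ^ 4 / fL 2 ^ 2 / ?d = hauptmodul"
    unfolding hauptmodul_def by (simp add: field_simps eval_nat_numeral)
  finally show ?thesis .
qed

text \<open>Dividing the relation for \<open>psi\<close> by
  \<open>q psi(q^5)^2 = q f_10^4 / f_5^2\<close> gives
  \<open>hauptmodul5 = hauptmodul4 + 1\<close>.\<close>

lemma hauptmodul5_eq: "hauptmodul5 = hauptmodul + 5"
proof -
  let ?d = "fls_X * fL 10 ^ 4 / fL 5 ^ 2"
  have "hauptmodul5 = fL 2 ^ 4 / fL 1 ^ 2 / ?d"
    unfolding hauptmodul5_def by (simp add: field_simps)
  also have "\<dots> = fL 2 * fL 5 ^ 3 / (fL 1 * fL 10) / ?d + 1"
    unfolding euler_relation_1_2_5_10 by (simp add: field_simps)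
  also have "fL 2 * fL 5 ^ 3 / (fL 1 * fL 10) / ?d = hauptmodul4"
    unfolding hauptmodul4_def by (simp add: field_simps eval_nat_numeral)
  finally show ?thesis by (simp add: hauptmodul4_eq add.commute)
qed

text \<open>The series \<open>g\<close> of the outline, which is
  \<open>eta(z)^4 eta(5 z)^4\<close>.\<close>

definition cusp_form :: "rat fls" where
  "cusp_form = fls_X * fL 1 ^ 4 * fL 5 ^ 4"

text \<open>The series \<open>h\<close> of the outline, which is \<open>eta(5 z)^5 / eta(z)\<close>,
  of weight 2.\<close>

definition core_form :: "rat fls" where
  "core_form = fls_X * fL 5 ^ 5 / fL 1"

lemma dilate_nonzero:
  assumes "F \<noteq> 0"
  shows "dilate F \<noteq> 0"
proof
  assume "dilate F = 0"
  then have "dilate (F / F) = 0" by (simp only: dilate_divide div_0)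
  then show False using assms by simp
qed

text \<open>Pure comparisons of exponents, valid for any nonzero field elements in place of
  \<open>q\<close> and the Euler products.\<close>

lemma eta_monomial_identities:
  fixes q f1 f2 f4 f5 f10 f20 :: "'a::field"
  assumes "q \<noteq> 0" "f1 \<noteq> 0" "f2 \<noteq> 0" "f4 \<noteq> 0" "f5 \<noteq> 0" "f10 \<noteq> 0" "f20 \<noteq> 0"
  shows "f1 ^ 3 * f5 / (q * f2 * f10 ^ 3) *
      ((f2 ^ 3 / (f1 * f4)) ^ 3 * (f10 ^ 3 / (f5 * f20)) / (- q * f2 * f10 ^ 3)) *
      (f4 * f10 ^ 5 / (q ^ 2 * f2 * f20 ^ 5)) = - ((f2 ^ 3 * f10 / (q ^ 2 * f4 * f20 ^ 3)) ^ 2)"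
    and "f2 * f5 ^ 5 / (q * f1 * f10 ^ 5) *
      (f2 * (f10 ^ 3 / (f5 * f20)) ^ 5 / (- q * (f2 ^ 3 / (f1 * f4)) * f10 ^ 5)) =
      - (f4 * f10 ^ 5 / (q ^ 2 * f2 * f20 ^ 5))"
    and "q * f5 ^ 5 / f1 = f2 * f5 ^ 5 / (q * f1 * f10 ^ 5) * (q ^ 2 * f10 ^ 5 / f2)"
    and "q * f1 ^ 4 * f5 ^ 4 = (f1 ^ 3 * f5 / (q * f2 * f10 ^ 3)) ^ 2 *
      (f2 ^ 4 * f5 ^ 2 / (q * f1 ^ 2 * f10 ^ 4)) * (q ^ 2 * f10 ^ 5 / f2) ^ 2"
    and "q ^ 2 * f2 ^ 4 * f10 ^ 4 *
      (f1 ^ 3 * f5 / (q * f2 * f10 ^ 3) * (f2 * f5 ^ 5 / (q * f1 * f10 ^ 5))) =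
      q * f1 ^ 4 * f5 ^ 4 * (f2 ^ 4 * f5 ^ 2 / (q * f1 ^ 2 * f10 ^ 4))"
  using assms by (simp_all add: field_simps eval_nat_numeral)

text \<open>The first two determine the symmetric functions of \<open>u(q)\<close> and
  \<open>u(-q)\<close>; the others express \<open>g\<close>, \<open>h\<close> and \<open>V g\<close>
  through \<open>u\<close>, \<open>V h\<close> and each other.\<close>

lemma eta_quotient_relations:
  "hauptmodul * reflect hauptmodul * dilate hauptmodul4 = - (dilate hauptmodul ^ 2)"
  "hauptmodul4 * reflect hauptmodul4 = - dilate hauptmodul4"
  "core_form = hauptmodul4 * dilate core_form"
  "cusp_form = hauptmodul ^ 2 * hauptmodul5 * dilate core_form ^ 2"
  "dilate cusp_form * (hauptmodul * hauptmodul4) = cusp_form * hauptmodul5"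
  unfolding hauptmodul_def hauptmodul4_def hauptmodul5_def core_form_def cusp_form_def
    dilate_simps reflect_simps reflect_fL
  by (rule eta_monomial_identities; (rule fL_nonzero | rule fls_X_nonzero))+

text \<open>With \<open>a = u(q)\<close>, \<open>b = u(-q)\<close>, \<open>U = u(q^2)\<close>,
  comparing the two hypotheses yields \<open>a + b\<close> in terms of \<open>U\<close>. The
  left-hand side is symmetric in \<open>a\<close> and \<open>b\<close>, hence determined by
  \<open>a + b\<close> and \<open>a * b\<close>.\<close>

lemma core_form_algebra:
  fixes a b U k :: "rat fls"
  assumes ab: "a * b * (U + 4) = - (U ^ 2)" and ab4: "(a + 4) * (b + 4) = - (U + 4)"
  shows "((a + 4) * ((U + 4) * k)) ^ 2 + ((b + 4) * ((U + 4) * k)) ^ 2 =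
    2 * (U ^ 2 * (U + 5) * k ^ 2 + 9 * ((U + 4) * k) ^ 2 - 8 * k ^ 2)"
proof -
  have s: "4 * ((a + b) * (U + 4)) = 4 * (- (6 * U + 20))"
    using ab ab4 by algebra
  then have s: "(a + b) * (U + 4) = - (6 * U + 20)"
    by (rule four_mult_cancel_fls)
  show ?thesis using ab s by algebra
qed

text \<open>As before, with \<open>G\<close> standing for \<open>g(q^4)\<close>. It is known only
  through its multiple by \<open>U * (U + 4)\<close>, so the claim is multiplied by this nonzero
  factor.\<close>

lemma cusp_form_algebra:
  fixes a b U k G :: "rat fls"
  assumes ab: "a * b * (U + 4) = - (U ^ 2)" and ab4: "(a + 4) * (b + 4) = - (U + 4)"
    and G: "G * (U * (U + 4)) = U ^ 2 * (U + 5) * k ^ 2 * (U + 5)" and U: "U \<noteq> 0" "U + 4 \<noteq> 0"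
  shows "a ^ 2 * (a + 5) * ((U + 4) * k) ^ 2 + b ^ 2 * (b + 5) * ((U + 4) * k) ^ 2 =
    2 * (- 4 * (U ^ 2 * (U + 5) * k ^ 2) - 8 * G)"
proof -
  have s: "4 * ((a + b) * (U + 4)) = 4 * (- (6 * U + 20))"
    using ab ab4 by algebra
  then have s: "(a + b) * (U + 4) = - (6 * U + 20)"
    by (rule four_mult_cancel_fls)
  have "U * (U + 4) * (a ^ 2 * (a + 5) * ((U + 4) * k) ^ 2 + b ^ 2 * (b + 5) * ((U + 4) * k) ^ 2) =
    U * (U + 4) * (2 * (- 4 * (U ^ 2 * (U + 5) * k ^ 2) - 8 * G))"
    using ab s G by algebra
  then show ?thesis using U by simp
qed

lemma reflect_dilate_core_form: "reflect (dilate core_form) = dilate core_form"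
  unfolding core_form_def dilate_simps reflect_simps reflect_fL by simp

text \<open>Common coordinates for both relations: \<open>h\<close> at \<open>q\<close>,
  \<open>-q\<close> and \<open>q^2\<close> is \<open>k = h(q^4)\<close> times a polynomial in
  \<open>a\<close>, \<open>b\<close>, \<open>U\<close>, and so \<open>g\<close> at these arguments
  is \<open>k^2\<close> times one.\<close>

context
  fixes a b U k :: "rat fls"
  defines "a \<equiv> hauptmodul" and "b \<equiv> reflect hauptmodul" and "U \<equiv> dilate hauptmodul"
    and "k \<equiv> dilate (dilate core_form)"
begin

lemma transformed_hauptmodul_eqs:
  "reflect hauptmodul4 = b + 4" "reflect hauptmodul5 = b + 5"
  "dilate hauptmodul4 = U + 4" "dilate hauptmodul5 = U + 5"
  by (simp_all add: b_def U_def hauptmodul4_eq hauptmodul5_eq reflect_add reflect_numeral dilate_numeral)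

lemma hauptmodul_eqs: "hauptmodul4 = a + 4" "hauptmodul5 = a + 5"
  by (simp_all add: a_def hauptmodul4_eq hauptmodul5_eq)

lemma modular_equations: "a * b * (U + 4) = - (U ^ 2)" "(a + 4) * (b + 4) = - (U + 4)"
  using eta_quotient_relations(1,2)
  unfolding transformed_hauptmodul_eqs unfolding hauptmodul_eqs unfolding a_def b_def U_def .

lemma dilate_core_form_eq: "dilate core_form = (U + 4) * k"
  using arg_cong[OF eta_quotient_relations(3), of dilate]
  unfolding fls_compose_power_mult transformed_hauptmodul_eqs k_def .

lemma core_form_eqs:
  "core_form = (a + 4) * ((U + 4) * k)" "reflect core_form = (b + 4) * ((U + 4) * k)"
  using eta_quotient_relations(3) arg_cong[OF eta_quotient_relations(3), of reflect]
  unfolding reflect_mult reflect_dilate_core_form transformed_hauptmodul_eqs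
  unfolding hauptmodul_eqs dilate_core_form_eq .

lemma cusp_form_eqs:
  "cusp_form = a ^ 2 * (a + 5) * ((U + 4) * k) ^ 2"
  "reflect cusp_form = b ^ 2 * (b + 5) * ((U + 4) * k) ^ 2"
  "dilate cusp_form = U ^ 2 * (U + 5) * k ^ 2"
proof -
  note c = eta_quotient_relations(4)
  show "cusp_form = a ^ 2 * (a + 5) * ((U + 4) * k) ^ 2"
    using c unfolding hauptmodul_eqs dilate_core_form_eq unfolding a_def .
  show "reflect cusp_form = b ^ 2 * (b + 5) * ((U + 4) * k) ^ 2"
    using arg_cong[OF c, of reflect]
    unfolding reflect_mult reflect_power reflect_dilate_core_form transformed_hauptmodul_eqs
    unfolding dilate_core_form_eq b_def .
  show "dilate cusp_form = U ^ 2 * (U + 5) * k ^ 2"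
    using arg_cong[OF c, of dilate]
    unfolding fls_compose_power_mult dilate_power transformed_hauptmodul_eqs unfolding U_def k_def .
qed

text \<open>A series plus its reflection is twice its even part. In terms of the Hecke operator,
  \<open>T_2 h^2 = g + 9 h^2\<close> with \<open>9 = 1 + 2^3\<close>.\<close>

lemma core_form_even_part:
  "core_form ^ 2 + reflect (core_form ^ 2) =
    2 * dilate (cusp_form + 9 * core_form ^ 2 - 8 * dilate core_form ^ 2)"
proof -
  have d: "dilate (cusp_form + 9 * core_form ^ 2 - 8 * dilate core_form ^ 2) =
      dilate cusp_form + 9 * dilate core_form ^ 2 - 8 * k ^ 2"
    by (simp add: dilate_numeral k_def)
  show ?thesis
    unfolding d reflect_power
    unfolding core_form_eqs(2) cusp_form_eqs(3) dilate_core_form_eq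
    unfolding core_form_eqs(1)
    by (rule core_form_algebra[OF modular_equations])
qed

text \<open>In terms of the Hecke operator, \<open>g\<close> is an eigenform of \<open>T_2\<close>
  with eigenvalue \<open>-4\<close>; the 8 is \<open>2^3\<close> for weight 4.\<close>

lemma cusp_form_even_part:
  "cusp_form + reflect cusp_form = 2 * dilate (- 4 * cusp_form - 8 * dilate cusp_form)"
proof -
  have d: "dilate (- 4 * cusp_form - 8 * dilate cusp_form) =
      - 4 * dilate cusp_form - 8 * dilate (dilate cusp_form)"
    by (simp add: dilate_numeral)
  have "dilate (dilate cusp_form) * (U * (U + 4)) = U ^ 2 * (U + 5) * k ^ 2 * (U + 5)"
    using arg_cong[OF eta_quotient_relations(5), of dilate]
    unfolding fls_compose_power_mult transformed_hauptmodul_eqs unfolding cusp_form_eqs(3) unfolding U_def .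
  moreover have "U \<noteq> 0"
    unfolding U_def by (rule dilate_nonzero) (simp add: hauptmodul_def)
  moreover have "U + 4 \<noteq> 0"
    unfolding transformed_hauptmodul_eqs(3)[symmetric] by (rule dilate_nonzero) (simp add: hauptmodul4_def)
  ultimately show ?thesis
    unfolding d
    unfolding cusp_form_eqs(2)
    unfolding cusp_form_eqs(3)
    unfolding cusp_form_eqs(1)
    by (intro cusp_form_algebra[OF modular_equations])
qed

end

section \<open>Iteration of the two relations and passage to coefficients\<close>

lemma nth_even_of_even_part:
  assumes "F + reflect F = 2 * dilate G"
  shows "fls_nth F (2 * n) = fls_nth G n"
proof -
  have "fls_nth (reflect F) (2 * n) = fls_nth F (2 * n)"
    unfolding reflect_def by (subst fls_nth_fls_compose_fps_linear) (simp_all add: power_int_minus_left)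
  then have "2 * fls_nth F (2 * n) = fls_nth (F + reflect F) (2 * n)" by simp
  also have "\<dots> = 2 * fls_nth G n"
    unfolding assms by (simp add: fls_nth_compose_power)
  finally show ?thesis by simp
qed

text \<open>The right-hand side of the theorem times \<open>q^2\<close>, so that only
  \<open>g\<close>, \<open>h^2\<close> and their images under \<open>V\<close> occur.\<close>

definition section_form :: "nat \<Rightarrow> rat fls" where
  "section_form k = fls_const (B k) * cusp_form - fls_const (8 * B (k - 1)) * dilate cusp_form
     + fls_const ((8 ^ (k + 1) - 1) / 7) * core_form ^ 2
     - fls_const ((8 ^ (k + 1) - 8) / 7) * dilate (core_form ^ 2)"

lemma nth_dilate_double: "fls_nth (dilate F) (2 * n) = fls_nth F n"
  by (simp add: fls_nth_compose_power)

text \<open>Taking the terms of even degree in \<open>section_form k\<close> replaces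
  \<open>g\<close> and \<open>h^2\<close> by their two relations and undoes \<open>V\<close>. The
  new coefficient of \<open>g\<close> is \<open>-4 B k - 8 B (k - 1) + (8^(k + 1) - 1)/7\<close>,
  the recurrence for \<open>B (k + 1)\<close>; that of \<open>h^2\<close> is
  \<open>(9 (8^(k + 1) - 1) - (8^(k + 1) - 8))/7 = (8^(k + 2) - 1)/7\<close>.\<close>

lemma nth_section_form:
  assumes "k \<ge> 1"
  shows "fls_nth (section_form k) n = fls_nth (core_form ^ 2) (2 ^ k * n)"
  using assms
proof (induction k arbitrary: n rule: nat_induct_at_least)
  case base
  have "section_form 1 = cusp_form + 9 * core_form ^ 2 - 8 * dilate core_form ^ 2"
    by (simp add: section_form_def)
  then show ?case
    using nth_even_of_even_part[OF core_form_even_part] by simp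
next
  case (Suc k)
  \<comment> \<open>Exposes \<open>Suc (Suc j)\<close>, the form in which \<open>B\<close>
    unfolds.\<close>
  obtain j where k: "k = Suc j" using Suc.hyps by (cases k) auto
  let ?c = "(8 ^ (k + 1) - 1) / 7 :: rat" and ?d = "(8 ^ (k + 1) - 8) / 7 :: rat"
  have "fls_nth (core_form ^ 2) (2 ^ Suc k * n) = fls_nth (section_form k) (2 * n)"
    using Suc.IH[of "2 * n"] by (simp add: ac_simps)
  also have "\<dots> = B k * fls_nth cusp_form (2 * n) - 8 * B (k - 1) * fls_nth cusp_form n
      + ?c * fls_nth (core_form ^ 2) (2 * n) - ?d * fls_nth (core_form ^ 2) n"
    by (simp add: section_form_def nth_dilate_double del: fls_compose_power_power)
  also have "fls_nth cusp_form (2 * n) = - 4 * fls_nth cusp_form n - 8 * fls_nth (dilate cusp_form) n"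
    using nth_even_of_even_part[OF cusp_form_even_part, of n] by simp
  also have "fls_nth (core_form ^ 2) (2 * n) = fls_nth cusp_form n + 9 * fls_nth (core_form ^ 2) n - 8 * fls_nth (dilate (core_form ^ 2)) n"
    using nth_even_of_even_part[OF core_form_even_part, of n] by simp
  also have "B k * (- 4 * fls_nth cusp_form n - 8 * fls_nth (dilate cusp_form) n) - 8 * B (k - 1) * fls_nth cusp_form n
      + ?c * (fls_nth cusp_form n + 9 * fls_nth (core_form ^ 2) n - 8 * fls_nth (dilate (core_form ^ 2)) n)
      - ?d * fls_nth (core_form ^ 2) n = fls_nth (section_form (Suc k)) n"
    by (simp add: section_form_def k field_simps del: fls_compose_power_power)
  finally show ?case by simp
qed

lemma core_form_square_eq: "core_form ^ 2 = fls_X ^ 2 * (fL 5 ^ 10 / fL 1 ^ 2)"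
  unfolding core_form_def by (simp add: power_mult_distrib power_divide flip: power_mult)

lemma nth_X_square_times: "fls_nth (fls_X ^ 2 * F) m = fls_nth (F :: rat fls) (m - 2)"
  by (simp add: fls_X_power_times_conv_shift)

text \<open>Since \<open>f_1^2\<close> has constant term 1, the quotient
  \<open>f_5^10 / f_1^2\<close> is a power series, and its coefficients of negative index
  vanish.\<close>

lemma nth_core_form_square: "fls_nth (core_form ^ 2) m = (if m \<ge> 2 then A5 (nat (m - 2)) else 0)"
proof -
  have sub: "subdegree (euler_f 1 ^ 2) = 0"
    by (rule subdegree_eq_0) (simp add: euler_f_def fps_nth_power_0)
  have "fL 5 ^ 10 / fL 1 ^ 2 = fps_to_fls (euler_f 5 ^ 10 * inverse (euler_f 1 ^ 2))"
    unfolding fL_def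
    by (simp only: divide_inverse fps_to_fls_power[symmetric] fls_inverse_fps_to_fls[OF sub] fls_times_fps_to_fls)
  then have neg: "fls_nth (fL 5 ^ 10 / fL 1 ^ 2) i = 0" if "i < 0" for i
    using that by simp
  have "fls_nth (core_form ^ 2) m = fls_nth (fL 5 ^ 10 / fL 1 ^ 2) (m - 2)"
    unfolding core_form_square_eq by (rule nth_X_square_times)
  then show ?thesis
    using neg[of "m - 2"] by (simp add: A5_def)
qed

lemma X_square_times_section:
  fixes x b c d e f g h u v w y :: "'a::field"
  assumes "x \<noteq> 0"
  shows "x ^ 2 * (b * u * v / x - c * w * y + d * f - e * (x ^ 2 * g / h)) =
    b * (x * u * v) - c * (x ^ 2 * w * y) + d * (x ^ 2 * f) - e * ((x ^ 2) ^ 2 * (g / h))"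
  using assms by (simp add: algebra_simps power2_eq_square)

theorem theorem1p1:
  fixes k :: nat
  assumes "k \<ge> 1"
  shows "\<forall>n::int.
    fls_nth
      (fls_const (B k) * fL 1 ^ 4 * fL 5 ^ 4 / fls_X
       - fls_const (8 * B (k - 1)) * fL 2 ^ 4 * fL 10 ^ 4
       + fls_const ((8 ^ (k + 1) - 1) / 7) * (fL 5 ^ 10 / fL 1 ^ 2)
       - fls_const ((8 ^ (k + 1) - 8) / 7) * (fls_X ^ 2 * fL 10 ^ 10 / fL 2 ^ 2)) n
    = (if n \<ge> -1 then A5 (nat (2 ^ k * n + 2 ^ (k + 1) - 2)) else 0)"
    (is "\<forall>n. fls_nth ?E n = _")
proof
  fix n :: int
  \<comment> \<open>Multiplication by \<open>q^2\<close> shifts the index by 2, so that index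
    \<open>n\<close> in the theorem is \<open>n + 2\<close> for
    \<open>section_form k\<close>.\<close>
  have "fls_X ^ 2 * ?E = section_form k"
    unfolding section_form_def core_form_square_eq cusp_form_def dilate_simps
    by (rule X_square_times_section) simp
  then have "fls_nth ?E n = fls_nth (section_form k) (n + 2)"
    using nth_X_square_times[of ?E "n + 2"] by (simp only: add_diff_cancel_right')
  also have "\<dots> = fls_nth (core_form ^ 2) (2 ^ k * (n + 2))"
    by (rule nth_section_form[OF assms])
  also have "\<dots> = (if n \<ge> -1 then A5 (nat (2 ^ k * n + 2 ^ (k + 1) - 2)) else 0)"
  proof -
    \<comment> \<open>The index in \<open>A5\<close> is \<open>2^k (n + 2) - 2\<close>. As
      \<open>k >= 1\<close>, it is nonnegative exactly from \<open>n = -1\<close> on, where the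
      Laurent series starts.\<close>
    have "(2 ^ k * (n + 2) \<ge> 2) = (n \<ge> -1)"
    proof
      assume "n \<ge> - 1"
      then have "(2 ^ 1 :: int) * 1 \<le> 2 ^ k * (n + 2)"
        using assms by (intro mult_mono power_increasing) auto
      then show "2 ^ k * (n + 2) \<ge> 2" by simp
    next
      assume "2 ^ k * (n + 2) \<ge> 2"
      then have "0 < 2 ^ k * (n + 2)" by linarith
      then show "n \<ge> - 1" by (simp add: zero_less_mult_iff)
    qed
    then show ?thesis by (simp add: nth_core_form_square algebra_simps)
  qed
  finally show "fls_nth ?E n = (if n \<ge> -1 then A5 (nat (2 ^ k * n + 2 ^ (k + 1) - 2)) else 0)" .
qed

end
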